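(* Let $X$ be a ball Banach function space on $\mathbb{R}^n$. (i) If $\gamma,q\in(0,\infty)$, then for every $f\in C^1(\mathbb{R}^n)$ with $|\nabla f|\in C_{\mathrm c}(\mathbb{R}^n)$, $$\limsup_{\lambda\to\infty}\lambda\left\|\left[\int_{\mathbb{R}^n}\mathbf{1}_{E_{\lambda,\gamma/q}[f]}(\cdot,y)|\cdot-y|^{\gamma-n}dy\right]^{1/q}\right\|_X\le\left[\frac{\kappa(q,n)}{\gamma}\right]^{1/q}\|\,|\nabla f|\,\|_X.$$ (ii) Let $p\in[1,\infty)$, $\gamma\in(-\infty,0)$, and $q\in(0,\frac{n-\gamma}{n}p)$. Assume that $X^{1/p}$ is a ball Banach function space and that the Hardy--Littlewood maximal operator $\mathcal{M}$ is bounded on $(X^{1/p})'$. Then for every $f\in C^1_{\mathrm c}(\mathbb{R}^n)$, $$\limsup_{\lambda\to0^+}\lambda\left\|\left[\int_{\mathbb{R}^n}\mathbf{1}_{E_{\lambda,\gamma/q}[f]}(\cdot,y)|\cdot-y|^{\gamma-n}dy\right]^{1/q}\right\|_X\le\left[-\frac{\kappa(q,n)}{\gamma}\right]^{1/q}\|\,|\nabla f|\,\|_X.$$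
   Context: A quasi-Banach space $X$ of measurable functions on $\mathbb{R}^n$ with quasi-norm defined on all measurable functions is a ball quasi-Banach function space if: $\|f\|_X=0$ implies $f=0$ a.e.; $|g|\le|f|$ a.e. implies $\|g\|_X\le\|f\|_X$; $0\le f_m\uparrow f$ a.e. implies $\|f_m\|_X\uparrow\|f\|_X$; $\mathbf{1}_B\in X$ for every ball $B$. It is a ball Banach function space if moreover the triangle inequality holds and for every ball $B$ there is $C_B$ with $\int_B|f|\le C_B\|f\|_X$. For $t>0$, $X^t:=\{f:|f|^t\in X\}$ with $\|f\|_{X^t}:=\|\,|f|^t\|_X^{1/t}$. Associate space: $Y':=\{f:\|f\|_{Y'}:=\sup_{\|g\|_Y=1}\|fg\|_{L^1}<\infty\}$. $\mathcal{M}$ is the Hardy--Littlewood maximal operator, bounded on $Y$ if $\|\mathcal{M}f\|_Y\le C\|f\|_Y$. $C^1_{\mathrm c}(\mathbb{R}^n)$ is the set of compactly supported $C^1$ functions. $E_{\lambda,\beta}[f]:=\{(x,y):x\ne y,\ |f(x)-f(y)|/|x-y|^{1+\beta}>\lambda\}$. $\kappa(q,n):=\int_{\mathbb{S}^{n-1}}|e\cdot\omega|^q\,d\omega$, $e$ a unit vector. *)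

theory Defs
  imports "HOL-Analysis.Analysis"
begin

text \<open>A (quasi-)norm functional N on measurable functions on the euclidean space 'a,
  with value \<infinity> for functions outside the space X.  X = {f measurable. N f < \<infinity>}.\<close>

abbreviation meas_fun :: "('a::euclidean_space \<Rightarrow> real) set" where
  "meas_fun \<equiv> borel_measurable lebesgue"

definition ball_quasi_BFS :: "(('a::euclidean_space \<Rightarrow> real) \<Rightarrow> ennreal) \<Rightarrow> bool" where
  "ball_quasi_BFS N \<longleftrightarrow>
     (\<exists>K::real. K \<ge> 1 \<and> (\<forall>f\<in>meas_fun. \<forall>g\<in>meas_fun.
         N (\<lambda>x. f x + g x) \<le> ennreal K * (N f + N g)))
   \<and> (\<forall>f\<in>meas_fun. \<forall>c::real. N (\<lambda>x. c * f x) = ennreal \<bar>c\<bar> * N f)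
   \<and> (\<forall>f\<in>meas_fun. N f = 0 \<longrightarrow> (AE x in lebesgue. f x = 0))
   \<and> (\<forall>f\<in>meas_fun. \<forall>g\<in>meas_fun.
         (AE x in lebesgue. \<bar>g x\<bar> \<le> \<bar>f x\<bar>) \<longrightarrow> N g \<le> N f)
   \<and> (\<forall>F f. (\<forall>k. F k \<in> meas_fun) \<and> f \<in> meas_fun
         \<and> (AE x in lebesgue. \<forall>k. 0 \<le> F k x \<and> F k x \<le> F (Suc k) x)
         \<and> (AE x in lebesgue. (\<lambda>k. F k x) \<longlonglongrightarrow> f x)
         \<longrightarrow> (\<lambda>k. N (F k)) \<longlonglongrightarrow> N f)
   \<and> (\<forall>c r. N (indicator (ball c r)) < \<infinity>)
   \<and> (\<forall>F. (\<forall>k. F k \<in> meas_fun \<and> N (F k) < \<infinity>)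
         \<and> (\<forall>e>0. \<exists>K. \<forall>m\<ge>K. \<forall>k\<ge>K. N (\<lambda>x. F m x - F k x) < e)
         \<longrightarrow> (\<exists>f\<in>meas_fun. N f < \<infinity> \<and> (\<lambda>k. N (\<lambda>x. F k x - f x)) \<longlonglongrightarrow> 0))"

definition ball_BFS :: "(('a::euclidean_space \<Rightarrow> real) \<Rightarrow> ennreal) \<Rightarrow> bool" where
  "ball_BFS N \<longleftrightarrow> ball_quasi_BFS N
   \<and> (\<forall>f\<in>meas_fun. \<forall>g\<in>meas_fun. N (\<lambda>x. f x + g x) \<le> N f + N g)
   \<and> (\<forall>c r. \<exists>C::real. \<forall>f\<in>meas_fun.
         (\<integral>\<^sup>+x\<in>ball c r. ennreal \<bar>f x\<bar> \<partial>lebesgue) \<le> ennreal C * N f)"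

definition enn_powr :: "ennreal \<Rightarrow> real \<Rightarrow> ennreal" where
  "enn_powr x t = (if x = \<infinity> then \<infinity> else ennreal (enn2real x powr t))"

definition convexify :: "(('a::euclidean_space \<Rightarrow> real) \<Rightarrow> ennreal) \<Rightarrow> real
    \<Rightarrow> ('a \<Rightarrow> real) \<Rightarrow> ennreal" where
  "convexify N t f = enn_powr (N (\<lambda>x. \<bar>f x\<bar> powr t)) (1 / t)"

definition assoc_norm :: "(('a::euclidean_space \<Rightarrow> real) \<Rightarrow> ennreal) \<Rightarrow> ('a \<Rightarrow> real) \<Rightarrow> ennreal" where
  "assoc_norm N f = (SUP g\<in>{g\<in>meas_fun. N g = 1}. \<integral>\<^sup>+x. ennreal \<bar>f x * g x\<bar> \<partial>lebesgue)"

definition maximal_op :: "('a::euclidean_space \<Rightarrow> real) \<Rightarrow> 'a \<Rightarrow> ennreal" where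
  "maximal_op f x = (SUP cr\<in>{(c, r). 0 < r \<and> x \<in> ball c r}.
      (\<integral>\<^sup>+y\<in>ball (fst cr) (snd cr). ennreal \<bar>f y\<bar> \<partial>lebesgue) / emeasure lebesgue (ball (fst cr) (snd cr)))"

definition maximal_bounded_on :: "(('a::euclidean_space \<Rightarrow> real) \<Rightarrow> ennreal) \<Rightarrow> bool" where
  "maximal_bounded_on Y \<longleftrightarrow> (\<exists>C::real. \<forall>f\<in>meas_fun. Y f < \<infinity> \<longrightarrow>
      (AE x in lebesgue. maximal_op f x < \<infinity>)
      \<and> Y (\<lambda>x. enn2real (maximal_op f x)) \<le> ennreal C * Y f)"

definition Eset :: "real \<Rightarrow> real \<Rightarrow> ('a::euclidean_space \<Rightarrow> real) \<Rightarrow> ('a \<times> 'a) set" where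
  "Eset t \<beta> f = {(x, y). x \<noteq> y \<and> \<bar>f x - f y\<bar> / norm (x - y) powr (1 + \<beta>) > t}"

definition Efun :: "real \<Rightarrow> real \<Rightarrow> real \<Rightarrow> ('a::euclidean_space \<Rightarrow> real) \<Rightarrow> 'a \<Rightarrow> real" where
  "Efun t \<gamma> q f x = (enn2real (\<integral>\<^sup>+y. indicator (Eset t (\<gamma> / q) f) (x, y)
      * ennreal (norm (x - y) powr (\<gamma> - real DIM('a))) \<partial>lebesgue)) powr (1 / q)"

text \<open>Integral over the unit sphere w.r.t. surface measure, via the standard identity
  \<integral>_{S^{n-1}} g d\<sigma> = n \<integral>_{B(0,1)} g(x/|x|) dx (surface measure defined as in Folland Thm 2.49).\<close>
definition sphere_integral :: "('a::euclidean_space \<Rightarrow> real) \<Rightarrow> real" where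
  "sphere_integral g = real DIM('a) * (LINT x : ball 0 1 | lebesgue. g (x /\<^sub>R norm x))"

definition kappa :: "real \<Rightarrow> 'a::euclidean_space itself \<Rightarrow> real" where
  "kappa q _ = sphere_integral (\<lambda>\<omega>::'a. \<bar>(SOME e::'a. norm e = 1) \<bullet> \<omega>\<bar> powr q)"

end

theory Submission
  imports Defs
begin

text \<open>
  Let \<open>\<omega> = (y - x) / |y - x|\<close>.  If \<open>|x - y| < \<delta>\<close>, uniform continuity of the gradient gives
  \<open>|f x - f y| \<le> (|Df x \<bullet> \<omega>| + \<epsilon>) |x - y|\<close>, so the section of \<open>E\<close> at \<open>x\<close>
  inside this ball lies in the set where \<open>t |x - y| powr (\<gamma> / q) < |Df x \<bullet> \<omega>| + \<epsilon>\<close>; in polar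
  coordinates its weighted measure is \<open>t powr - q / |\<gamma>|\<close> times the integral of
  \<open>(|Df x \<bullet> \<omega>| + \<epsilon>) powr q\<close> over the sphere, uniformly in \<open>x\<close>.  For \<open>\<gamma> > 0\<close> and large \<open>t\<close>
  the whole section lies in that ball, which gives (i).

  For \<open>\<gamma> < 0\<close> the remaining part is negligible as \<open>t\<close> tends to 0: for \<open>x\<close> in a bounded set
  because its weighted measure is bounded independently of \<open>t\<close>, and for \<open>x\<close> far away because the
  function is then at most a multiple of \<open>|x| powr - s\<close> with \<open>s = (n - \<gamma>) / q > n / p\<close>, which
  lies in \<open>X\<close> near infinity.  The latter holds since boundedness of the maximal operator on
  the associate space of \<open>Y = X\<^sup>1\<^sup>/\<^sup>p\<close> implies, by duality, that the norm in \<open>Y\<close> of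
  the indicator of a ball of radius \<open>r \<ge> 1\<close> is \<open>O(r\<^sup>n)\<close>.
\<close>

subsection \<open>Duality in ball Banach function spaces\<close>

text \<open>Three obstacles shape the argument. The constant is sharp, so a splitting may cost only
  a factor \<open>1 + \<eta>\<close>. Unless \<open>q = 1\<close>, one of the powers
  \<open>q\<close> and \<open>1 / q\<close> fails to be subadditive; both go through
  \<open>(a + b) powr s \<le> (1 + \<eta>) * a powr s + C * b powr s\<close>, where \<open>C\<close>
  may depend on \<eta> but not on \<epsilon>. An error \<epsilon> that is merely uniform in x is
  worthless on the whole space, since constants need not have finite norm. It is confined to a ball,
  outside of which the section is empty (\<gamma> > 0, t large) or the decaying bound takes over
  (\<gamma> < 0). The exponent s is that of \<open>|x| powr (\<gamma> - n)\<close>, the size of the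
  weight on the distant support of f, after the root \<open>1 / q\<close>; the bound on q says
  exactly that \<open>s * p > n\<close>. The maximal operator is controlled on the associate space
  only, so its information must be carried back to Y. This needs a norming functional that is a
  function, which the dual space need not supply. As only indicators of balls are tested, it can be
  found by projection in L2 rather than by a separation theorem in Y.\<close>

lemma integrable_bounded_on_ball:
  fixes f :: "'a::euclidean_space \<Rightarrow> real"
  assumes "f \<in> meas_fun" and "\<And>x. \<bar>f x\<bar> \<le> M * indicator (ball c r) x"
  shows "integrable lebesgue f"
proof (rule Bochner_Integration.integrable_bound)
  show "integrable lebesgue (\<lambda>x. M * indicator (ball c r) x)"
    using emeasure_lborel_ball_finite[of c r]
    by (intro integrable_mult_right) (simp add: integrable_indicator_iff)
  show "AE x in lebesgue. norm (f x) \<le> norm (M * indicator (ball c r) x)"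
    using assms(2) by (intro AE_I2) (metis abs_ge_self order_trans real_norm_def)
qed fact

text \<open>A minimising sequence is Cauchy in mean square by the parallelogram law, hence converges
  almost everywhere along a fast subsequence.\<close>

lemma L2_nearest_point:
  fixes u :: "'a::euclidean_space \<Rightarrow> real"
  assumes u[measurable]: "u \<in> meas_fun" and uM: "\<And>x. u x \<le> M * indicator (ball c r) x"
    and K: "\<And>k. k \<in> K \<Longrightarrow> k \<in> meas_fun" "\<And>k x. k \<in> K \<Longrightarrow> 0 \<le> k x" "\<And>k x. k \<in> K \<Longrightarrow> k x \<le> u x"
    and ne: "k0 \<in> K"
    and mid: "\<And>k l. k \<in> K \<Longrightarrow> l \<in> K \<Longrightarrow> (\<lambda>x. (k x + l x) / 2) \<in> K"
    and closed: "\<And>h l. (\<And>n. h n \<in> K) \<Longrightarrow> l \<in> meas_fun \<Longrightarrow> (\<And>x. 0 \<le> l x) \<Longrightarrow> (\<And>x. l x \<le> u x) \<Longrightarrow>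
        (AE x in lebesgue. (\<lambda>n. h n x) \<longlonglongrightarrow> l x) \<Longrightarrow> l \<in> K"
  obtains l where "l \<in> K" "\<And>k. k \<in> K \<Longrightarrow> (LINT x|lebesgue. (u x - l x)\<^sup>2) \<le> (LINT x|lebesgue. (u x - k x)\<^sup>2)"
proof -
  define Q where "Q k = (LINT x|lebesgue. (u x - k x)\<^sup>2)" for k
  define d where "d = (INF k\<in>K. Q k)"
  define B where "B = ball c r"
  define mB where "mB = measure lebesgue B"
  have u0: "0 \<le> u x" for x using K(2,3)[OF ne, of x] by linarith
  have M0: "M * indicator B x \<ge> 0" for x using u0[of x] uM[of x] by (simp add: B_def)
  have uind: "u x = u x * indicator B x" for x
    using u0[of x] uM[of x] by (auto simp: indicator_def B_def split: if_splits)
  have bnd: "f x \<le> M\<^sup>2 * indicator B x" if "\<bar>a\<bar> \<le> u x" "f x = a\<^sup>2" for f and a x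
  proof (cases "x \<in> B")
    case True
    then have "\<bar>a\<bar> \<le> M" using that uM[of x] by (simp add: B_def)
    then have "a\<^sup>2 \<le> M\<^sup>2" by (metis abs_ge_zero power2_abs power_mono)
    then show ?thesis using True that by simp
  next
    case False
    then have "a = 0" using that uind[of x] by simp
    then show ?thesis using that False by simp
  qed
  have intQ: "integrable lebesgue (\<lambda>x. (k x - l x)\<^sup>2)"
    if "k \<in> meas_fun" "l \<in> meas_fun" "\<And>x. \<bar>k x - l x\<bar> \<le> u x" for k l
    by (rule integrable_bounded_on_ball[where M="M\<^sup>2" and c=c and r=r])
       (use that bnd in \<open>auto simp: B_def\<close>)
  have inA: "integrable lebesgue (\<lambda>x. (u x - k x)\<^sup>2)" if "k \<in> K" for k
    using K[OF that] by (intro intQ) (auto intro: order_trans[OF abs_ge_self] simp: abs_le_iff u0)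
  have inB: "integrable lebesgue (\<lambda>x. (k x - l x)\<^sup>2)" if "k \<in> K" "l \<in> K" for k l
  proof (rule intQ)
    fix x show "\<bar>k x - l x\<bar> \<le> u x" using K(2,3)[OF that(1), of x] K(2,3)[OF that(2), of x] by linarith
  qed (use K that in auto)
  have bdd: "bdd_below (Q ` K)"
    by (rule bdd_belowI2[of _ 0]) (simp add: Q_def)
  \<comment> \<open>The rate \<open>(1/4)^n\<close> makes consecutive terms O(2^-n) apart in L2,
    which is summable; no further subsequence is needed.\<close>
  have "\<exists>k. k \<in> K \<and> Q k < d + (1/4)^n" for n :: nat
  proof -
    have "(INF k\<in>K. Q k) < d + (1/4)^n" by (simp add: d_def)
    then show ?thesis using ne bdd by (subst (asm) cINF_less_iff) auto
  qed
  then obtain h where h: "\<And>n. h n \<in> K" "\<And>n. Q (h n) < d + (1/4)^n"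
    by metis
  have [measurable]: "h n \<in> meas_fun" for n using h(1) K(1) by blast
  have dle: "d \<le> Q k" if "k \<in> K" for k
    unfolding d_def by (rule cINF_lower[OF bdd that])
  have sq: "(LINT x|lebesgue. (h (Suc n) x - h n x)\<^sup>2) \<le> 4 * (1/4)^n" for n
  proof -
    let ?m = "\<lambda>x. (h (Suc n) x + h n x) / 2"
    have m: "?m \<in> K" using mid h(1) by blast
    have "(LINT x|lebesgue. (h (Suc n) x - h n x)\<^sup>2)
       = (LINT x|lebesgue. 2 * (u x - h (Suc n) x)\<^sup>2 + 2 * (u x - h n x)\<^sup>2 - 4 * (u x - ?m x)\<^sup>2)"
      by (rule Bochner_Integration.integral_cong) (auto simp: power2_eq_square field_simps)
    also have "\<dots> = 2 * Q (h (Suc n)) + 2 * Q (h n) - 4 * Q ?m"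
      using inA[OF h(1)[of n]] inA[OF h(1)[of "Suc n"]] inA[OF m] by (simp add: Q_def)
    also have "\<dots> \<le> 2 * (1/4)^(Suc n) + 2 * (1/4)^n"
      using h(2)[of n] h(2)[of "Suc n"] dle[OF m] by linarith
    also have "\<dots> \<le> 4 * (1/4)^n" by simp
    finally show ?thesis .
  qed
  \<comment> \<open>Weighted AM-GM: a mean-square bound of order 4^-n becomes a mean bound of order
    2^-n, the additive term being integrated only over \<open>B\<close>, of finite measure.\<close>
  have amgm: "\<bar>a\<bar> \<le> (2^n * a\<^sup>2 + (1/2)^n) / 2" for a :: real and n :: nat
  proof -
    have "0 \<le> (2^n * \<bar>a\<bar> - 1)\<^sup>2 * (1/2)^n" by simp
    also have "\<dots> = ((2::real)^n * (1/2)^n) * (2^n * a\<^sup>2) - 2 * ((2::real)^n * (1/2)^n) * \<bar>a\<bar> + (1/2)^n"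
      by (simp add: power2_eq_square algebra_simps abs_mult_self_eq)
    also have "(2::real)^n * (1/2)^n = 1" by (simp flip: power_mult_distrib)
    finally show ?thesis by simp
  qed
  have L1: "(\<integral>\<^sup>+x. ennreal \<bar>h (Suc n) x - h n x\<bar> \<partial>lebesgue) \<le> ennreal ((2 + mB) * (1/2)^n)" for n
  proof -
    let ?s = "\<lambda>x. (h (Suc n) x - h n x)\<^sup>2"
    let ?g = "\<lambda>x. (2^n * ?s x + (1/2)^n * indicator B x) / 2"
    have iB: "integrable lebesgue (indicator B :: 'a \<Rightarrow> real)"
      using emeasure_lborel_ball_finite[of c r] by (simp add: integrable_indicator_iff B_def)
    have iS: "integrable lebesgue ?s" using inB h(1) by blast
    have "\<bar>h (Suc n) x - h n x\<bar> \<le> ?g x" for x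
    proof (cases "x \<in> B")
      case True
      then show ?thesis using amgm[of "h (Suc n) x - h n x" n] by simp
    next
      case False
      then have "u x = 0" using uind[of x] by simp
      then have "h (Suc n) x = 0" "h n x = 0" using K(2,3)[OF h(1), of _ x] by (metis order_antisym)+
      then show ?thesis by simp
    qed
    then have "(\<integral>\<^sup>+x. ennreal \<bar>h (Suc n) x - h n x\<bar> \<partial>lebesgue) \<le> (\<integral>\<^sup>+x. ennreal (?g x) \<partial>lebesgue)"
      by (intro nn_integral_mono ennreal_leI)
    also have "\<dots> = ennreal (LINT x|lebesgue. ?g x)"
      using iS iB by (intro nn_integral_eq_integral) auto
    also have "(LINT x|lebesgue. ?g x) = (2^n * (LINT x|lebesgue. ?s x) + (1/2)^n * mB) / 2"
      using iS iB by (simp add: mB_def)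
    also have "\<dots> \<le> (2^n * (4 * (1/4)^n) + (1/2)^n * mB) / 2"
      using sq[of n] by (intro divide_right_mono add_right_mono mult_left_mono) auto
    also have "\<dots> = 2 * (2^n * (1/4)^n) + (1/2)^n * mB / 2" by simp
    also have "(2::real)^n * (1/4)^n = (1/2)^n" by (simp flip: power_mult_distrib)
    also have "2 * (1/2)^n + (1/2)^n * mB / 2 \<le> (2 + mB) * (1/2)^n"
      by (simp add: mB_def algebra_simps)
    finally show ?thesis by (simp add: ennreal_leI)
  qed
  have "(\<integral>\<^sup>+x. (\<Sum>n. ennreal \<bar>h (Suc n) x - h n x\<bar>) \<partial>lebesgue) = (\<Sum>n. \<integral>\<^sup>+x. ennreal \<bar>h (Suc n) x - h n x\<bar> \<partial>lebesgue)"
    by (rule nn_integral_suminf) measurable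
  also have "\<dots> \<le> (\<Sum>n. ennreal ((2 + mB) * (1/2)^n))"
    by (intro suminf_le L1) auto
  also have "\<dots> < top"
    by (subst suminf_ennreal2) (auto simp: mB_def intro!: summable_mult summable_geometric)
  finally have "AE x in lebesgue. (\<Sum>n. ennreal \<bar>h (Suc n) x - h n x\<bar>) \<noteq> \<infinity>"
    by (intro nn_integral_noteq_infinite) auto
  then have conv: "AE x in lebesgue. convergent (\<lambda>n. h n x)"
  proof eventually_elim
    case (elim x)
    then have "summable (\<lambda>n. \<bar>h (Suc n) x - h n x\<bar>)"
      by (intro summable_suminf_not_top) auto
    then have "summable (\<lambda>n. h (Suc n) x - h n x)"
      by (rule summable_rabs_cancel)
    then have "convergent (\<lambda>n. h n x - h 0 x)"
      using sum_lessThan_telescope[of "\<lambda>n. h n x"] by (simp add: summable_iff_convergent)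
    then have "convergent (\<lambda>n. h 0 x + (h n x - h 0 x))"
      by (subst convergent_add_const_iff)
    then show ?case by simp
  qed
  \<comment> \<open>Clamping makes the order constraints hold at every point, also on the null set
    where the sequence may diverge and \<open>lim\<close> is arbitrary.\<close>
  define l where "l x = max 0 (min (u x) (lim (\<lambda>n. h n x)))" for x
  have [measurable]: "l \<in> meas_fun" unfolding l_def by measurable
  have l0: "0 \<le> l x" "l x \<le> u x" for x using u0 by (auto simp: l_def)
  have lim: "AE x in lebesgue. (\<lambda>n. h n x) \<longlonglongrightarrow> l x"
    using conv
  proof eventually_elim
    case (elim x)
    then have *: "(\<lambda>n. h n x) \<longlonglongrightarrow> lim (\<lambda>n. h n x)" by (simp add: convergent_LIMSEQ_iff)
    have "0 \<le> lim (\<lambda>n. h n x)" "lim (\<lambda>n. h n x) \<le> u x"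
      using K(2,3)[OF h(1)] by (auto intro: LIMSEQ_le_const[OF *] LIMSEQ_le_const2[OF *])
    then show ?case using * by (simp add: l_def)
  qed
  have lK: "l \<in> K" by (rule closed[of h]) (use h l0 lim in auto)
  have "(\<lambda>n. Q (h n)) \<longlonglongrightarrow> Q l"
    unfolding Q_def
  proof (rule integral_dominated_convergence)
    show "integrable lebesgue (\<lambda>x. (u x - 0)\<^sup>2)"
      using intQ[of u "\<lambda>_. 0"] u0 by simp
    show "AE x in lebesgue. (\<lambda>n. (u x - h n x)\<^sup>2) \<longlonglongrightarrow> (u x - l x)\<^sup>2"
      using lim by eventually_elim (intro tendsto_intros)
    show "AE x in lebesgue. norm ((u x - h n x)\<^sup>2) \<le> (u x - 0)\<^sup>2" for n
      using K(2,3)[OF h(1)[of n]] by (intro AE_I2) (simp add: power_mono)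
  qed measurable
  moreover have "(\<lambda>n. d + (1/4)^n) \<longlonglongrightarrow> d + 0"
    by (intro tendsto_intros LIMSEQ_power_zero) simp
  ultimately have "Q l \<le> d + 0"
    by (rule LIMSEQ_le) (use h(2) in \<open>auto intro: less_imp_le\<close>)
  then show thesis
    using that lK dle unfolding Q_def by fastforce
qed

locale ball_BFS_space =
  fixes N :: "('a::euclidean_space \<Rightarrow> real) \<Rightarrow> ennreal"
  assumes BFS: "ball_BFS N"
begin

lemma qBFS: "ball_quasi_BFS N"
  using BFS by (simp add: ball_BFS_def)

lemma N_scale: "f \<in> meas_fun \<Longrightarrow> N (\<lambda>x. c * f x) = ennreal \<bar>c\<bar> * N f"
  using qBFS by (simp add: ball_quasi_BFS_def)

lemma N_definite: "f \<in> meas_fun \<Longrightarrow> N f = 0 \<Longrightarrow> AE x in lebesgue. f x = 0"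
  using qBFS by (simp add: ball_quasi_BFS_def)

lemma N_mono_AE: "f \<in> meas_fun \<Longrightarrow> g \<in> meas_fun \<Longrightarrow> AE x in lebesgue. \<bar>g x\<bar> \<le> \<bar>f x\<bar> \<Longrightarrow> N g \<le> N f"
  using qBFS by (simp add: ball_quasi_BFS_def)

lemma N_mono: "f \<in> meas_fun \<Longrightarrow> g \<in> meas_fun \<Longrightarrow> (\<And>x. 0 \<le> g x) \<Longrightarrow> (\<And>x. g x \<le> f x) \<Longrightarrow> N g \<le> N f"
  by (rule N_mono_AE) (auto intro!: AE_I2 intro: order_trans[OF _ abs_ge_self])

lemma N_triangle: "f \<in> meas_fun \<Longrightarrow> g \<in> meas_fun \<Longrightarrow> N (\<lambda>x. f x + g x) \<le> N f + N g"
  using BFS by (simp add: ball_BFS_def)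

lemma N_mono_conv:
  assumes "\<And>k. F k \<in> meas_fun" "f \<in> meas_fun" "\<And>k x. 0 \<le> F k x" "\<And>k x. F k x \<le> F (Suc k) x"
    and "AE x in lebesgue. (\<lambda>k. F k x) \<longlonglongrightarrow> f x"
  shows "(\<lambda>k. N (F k)) \<longlonglongrightarrow> N f"
proof -
  have "\<forall>F f. (\<forall>k. F k \<in> meas_fun) \<and> f \<in> meas_fun
         \<and> (AE x in lebesgue. \<forall>k. 0 \<le> F k x \<and> F k x \<le> F (Suc k) x)
         \<and> (AE x in lebesgue. (\<lambda>k. F k x) \<longlonglongrightarrow> f x)
         \<longrightarrow> (\<lambda>k. N (F k)) \<longlonglongrightarrow> N f"
    using qBFS unfolding ball_quasi_BFS_def by (elim conjE)
  then show ?thesis using assms by simp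
qed

lemma N_ball_finite: "N (indicator (ball c r)) < \<infinity>"
  using qBFS by (simp add: ball_quasi_BFS_def)

lemma ball_meas [measurable]: "indicator (ball c r) \<in> meas_fun"
  by (intro borel_measurable_indicator) simp

lemma N_abs: "f \<in> meas_fun \<Longrightarrow> N (\<lambda>x. \<bar>f x\<bar>) = N f"
  by (rule antisym; rule N_mono_AE) auto

lemma N_0: "N (\<lambda>x. 0) = 0"
  using N_scale[of "\<lambda>_. 0" 0] by simp

lemma N_ball_pos:
  assumes "r > 0" shows "N (indicator (ball c r)) > 0"
proof (rule ccontr)
  assume "\<not> ?thesis"
  then have "AE x in lebesgue. indicator (ball c r) x = (0::real)"
    by (intro N_definite) (auto simp: ball_meas)
  then have "AE x in lebesgue. x \<notin> ball c r"
    by eventually_elim (auto simp: indicator_def split: if_splits)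
  then have "emeasure lebesgue (ball c r) = 0"
    by (subst (asm) AE_iff_measurable[of "ball c r"]) auto
  then have "measure lebesgue (ball c r) = 0" by (simp add: measure_def)
  then show False using content_ball_pos[OF assms, of c] by simp
qed

text \<open>The axiom covers increasing sequences only, so it is applied to the tail infima
  \<open>F k\<close>, which increase to the same limit. This makes N-balls closed under convergence
  almost everywhere, as the projection in L2 requires.\<close>

lemma N_Fatou:
  assumes h[measurable]: "\<And>n. h n \<in> meas_fun" and h0: "\<And>n x. 0 \<le> h n x"
    and l[measurable]: "l \<in> meas_fun" and lim: "AE x in lebesgue. (\<lambda>n. h n x) \<longlonglongrightarrow> l x"
    and D: "\<And>n. N (h n) \<le> D"
  shows "N l \<le> D"
proof -
  define F where "F k x = (INF m\<in>{k..}. h m x)" for k x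
  have bdd: "bdd_below ((\<lambda>m. h m x) ` A)" for x A
    using h0 by (auto intro!: bdd_belowI2)
  have [measurable]: "F k \<in> meas_fun" for k
    unfolding F_def by (rule borel_measurable_cINF) (auto simp: bdd)
  have F0: "0 \<le> F k x" for k x
    unfolding F_def by (rule cINF_greatest) (auto simp: h0)
  have Fle: "F k x \<le> h k x" for k x
    unfolding F_def by (rule cINF_lower[OF bdd]) auto
  have Finc: "F k x \<le> F (Suc k) x" for k x
    unfolding F_def by (rule cINF_superset_mono) (auto simp: bdd)
  have Flim: "AE x in lebesgue. (\<lambda>k. F k x) \<longlonglongrightarrow> l x"
    using lim
  proof eventually_elim
    case (elim x)
    show ?case
    proof (rule LIMSEQ_I)
      fix e :: real assume "e > 0"
      then obtain K where K: "\<And>n. n \<ge> K \<Longrightarrow> \<bar>h n x - l x\<bar> < e / 2"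
        using LIMSEQ_D[OF elim, of "e/2"] by auto
      have "norm (F n x - l x) < e" if "n \<ge> K" for n
      proof -
        have "l x - e / 2 \<le> F n x"
          unfolding F_def
        proof (rule cINF_greatest)
          fix m assume "m \<in> {n..}"
          then have "\<bar>h m x - l x\<bar> < e / 2" using K that by simp
          then show "l x - e / 2 \<le> h m x" by linarith
        qed simp
        then show ?thesis using Fle[of n x] K[OF that] \<open>e > 0\<close> unfolding real_norm_def by linarith
      qed
      then show "\<exists>K. \<forall>n\<ge>K. norm (F n x - l x) < e" by blast
    qed
  qed
  have "(\<lambda>k. N (F k)) \<longlonglongrightarrow> N l"
    by (rule N_mono_conv) (auto simp: F0 Finc Flim)
  moreover have "N (F k) \<le> D" for k
    using N_mono[of "h k" "F k"] F0 Fle D[of k] by (force intro: order_trans)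
  ultimately show ?thesis
    by (intro LIMSEQ_le_const2) auto
qed

text \<open>The part of the Lorentz-Luxemburg theorem needed here.  The functional is
  u minus its L2-projection onto the N-ball of radius D.\<close>

lemma N_le_by_duality:
  assumes u[measurable]: "u \<in> meas_fun" and u0: "\<And>x. 0 \<le> u x" and uM: "\<And>x. u x \<le> M * indicator (ball c r) x"
    and D: "D > 0"
    and dual: "\<And>g. g \<in> meas_fun \<Longrightarrow> (\<integral>\<^sup>+x. ennreal (u x * \<bar>g x\<bar>) \<partial>lebesgue) \<le> ennreal D * assoc_norm N g"
  shows "N u \<le> ennreal D"
proof -
  define B where "B = ball c r"
  have [measurable]: "B \<in> sets lebesgue" by (simp add: B_def)
  \<comment> \<open>The constraint \<open>k x \<le> u x\<close> keeps every competitor bounded with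
    support in one ball, which makes L2 available although X and L2 are unrelated.\<close>
  define K where "K = {k \<in> meas_fun. (\<forall>x. 0 \<le> k x \<and> k x \<le> u x) \<and> N k \<le> ennreal D}"
  have cvx: "N (\<lambda>x. (1 - t) * k x + t * l x) \<le> ennreal D"
    if [measurable]: "k \<in> meas_fun" "l \<in> meas_fun" and "N k \<le> ennreal D" "N l \<le> ennreal D" and t: "0 \<le> t" "t \<le> 1" for k l t
  proof -
    have "N (\<lambda>x. (1 - t) * k x + t * l x) \<le> N (\<lambda>x. (1 - t) * k x) + N (\<lambda>x. t * l x)"
      by (rule N_triangle) measurable
    also have "\<dots> = ennreal (1 - t) * N k + ennreal t * N l"
      using t by (simp add: N_scale that)
    also have "\<dots> \<le> ennreal (1 - t) * ennreal D + ennreal t * ennreal D"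
      by (intro add_mono mult_left_mono that) auto
    also have "\<dots> = ennreal D"
      using t D by (simp flip: ennreal_mult ennreal_plus add: algebra_simps)
    finally show ?thesis .
  qed
  have zero: "(\<lambda>x. 0) \<in> K" by (simp add: K_def u0 N_0)
  obtain l where lK: "l \<in> K"
    and lmin: "\<And>k. k \<in> K \<Longrightarrow> (LINT x|lebesgue. (u x - l x)\<^sup>2) \<le> (LINT x|lebesgue. (u x - k x)\<^sup>2)"
  proof (rule L2_nearest_point[OF u uM _ _ _ zero])
    show "(\<lambda>x. (k x + l x) / 2) \<in> K" if "k \<in> K" "l \<in> K" for k l
    proof -
      have "N (\<lambda>x. (1 - 1/2) * k x + 1/2 * l x) \<le> ennreal D"
        using that by (intro cvx) (auto simp: K_def)
      moreover have "(\<lambda>x. (1 - 1/2) * k x + 1/2 * l x) = (\<lambda>x. (k x + l x) / 2)"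
        by (auto simp: field_simps)
      ultimately show ?thesis
        using that by (auto simp: K_def) (smt (verit) field_sum_of_halves)
    qed
    show "l \<in> K" if "\<And>n. h n \<in> K" "l \<in> meas_fun" "\<And>x. 0 \<le> l x" "\<And>x. l x \<le> u x"
      "AE x in lebesgue. (\<lambda>n. h n x) \<longlonglongrightarrow> l x" for h l
      using that N_Fatou[of h l "ennreal D"] by (auto simp: K_def)
  qed (auto simp: K_def)
  have l[measurable]: "l \<in> meas_fun" and l0: "\<And>x. 0 \<le> l x" and lu: "\<And>x. l x \<le> u x" and Nl: "N l \<le> ennreal D"
    using lK by (auto simp: K_def)
  define g where "g x = u x - l x" for x
  have [measurable]: "g \<in> meas_fun" unfolding g_def by measurable
  have g0: "0 \<le> g x" "g x \<le> u x" for x using lu l0 by (auto simp: g_def)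
  have gB: "g x \<le> M * indicator B x" "l x \<le> M * indicator B x" for x
    using g0[of x] uM[of x] lu[of x] by (auto simp: B_def)
  have g_out: "g x = 0" if "x \<notin> B" for x using gB[of x] g0[of x] that by simp
  have bound_int: "integrable lebesgue (\<lambda>x. a x * b x)"
    if "a \<in> meas_fun" "b \<in> meas_fun" "\<And>x. \<bar>a x\<bar> \<le> m * indicator B x" "\<And>x. \<bar>b x\<bar> \<le> m' * indicator B x" for a b m m'
  proof (rule integrable_bounded_on_ball)
    fix x
    have "\<bar>a x * b x\<bar> \<le> (m * indicator B x) * (m' * indicator B x)"
      unfolding abs_mult using that(3,4)[of x] by (intro mult_mono) auto
    then show "\<bar>a x * b x\<bar> \<le> (m * m') * indicator (ball c r) x"
      by (auto simp: B_def indicator_def split: if_splits)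
  qed (use that in measurable)
  have gabs: "\<bar>g x\<bar> \<le> M * indicator B x" "\<bar>l x\<bar> \<le> M * indicator B x" for x
    using gB g0 l0 by auto
  define A where "A = (LINT x|lebesgue. g x * l x)"
  have A0: "A \<ge> 0" unfolding A_def using g0 l0 by (intro integral_nonneg_AE) auto
  \<comment> \<open>First-order condition at the nearest point \<open>l\<close>: moving from
    \<open>l\<close> towards \<open>k\<close> cannot bring one closer to \<open>u\<close>. The
    competitor \<open>k\<close> need not lie below \<open>u\<close>, since cutting the moved point
    off at \<open>u\<close> only shortens the distance to \<open>u\<close>.\<close>
  have var: "(LINT x|lebesgue. g x * k x) \<le> A"
    if [measurable]: "k \<in> meas_fun" and k0: "\<And>x. 0 \<le> k x" and kj: "\<And>x. k x \<le> j * indicator B x" and Nk: "N k \<le> ennreal D" for k j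
  proof (rule ccontr)
    assume contra: "\<not> ?thesis"
    have kabs: "\<bar>k x\<bar> \<le> j * indicator B x" for x using k0 kj by simp
    have klabs: "\<bar>k x - l x\<bar> \<le> (\<bar>j\<bar> + \<bar>M\<bar>) * indicator B x" for x
      using kabs[of x] gabs(2)[of x] by (cases "x \<in> B") auto
    have i1: "integrable lebesgue (\<lambda>x. g x * k x)" "integrable lebesgue (\<lambda>x. g x * l x)"
      "integrable lebesgue (\<lambda>x. g x * (k x - l x))" "integrable lebesgue (\<lambda>x. (k x - l x) * (k x - l x))"
      "integrable lebesgue (\<lambda>x. g x * g x)"
      by (rule bound_int; (rule gabs kabs klabs)?; measurable)+
    define P where "P = (LINT x|lebesgue. g x * (k x - l x))"
    define S where "S = (LINT x|lebesgue. (k x - l x) * (k x - l x))"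
    have "P = (LINT x|lebesgue. g x * k x) - A"
      unfolding P_def A_def using i1 by (simp add: right_diff_distrib)
    then have P: "P > 0" using contra by simp
    have S: "S \<ge> 0" unfolding S_def by (intro integral_nonneg_AE) auto
    \<comment> \<open>Small enough that the quadratic term \<open>t\<^sup>2 * S\<close> cannot make
      up for the linear gain \<open>2 * t * P\<close>; adding 1 avoids a division by zero.\<close>
    define t where "t = min 1 (P / (S + 1))"
    have t: "0 < t" "t \<le> 1" "t * S < P"
    proof -
      show "0 < t" "t \<le> 1" using P S by (auto simp: t_def)
      have "t * S \<le> P / (S + 1) * S" using S by (intro mult_right_mono) (auto simp: t_def)
      also have "\<dots> < P" using P S by (simp add: field_simps)
      finally show "t * S < P" .
    qed
    define m where "m x = (1 - t) * l x + t * k x" for x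
    have [measurable]: "m \<in> meas_fun" unfolding m_def by measurable
    have m0: "0 \<le> m x" for x using t l0 k0 by (simp add: m_def)
    have Nm: "N m \<le> ennreal D" unfolding m_def using t Nl Nk by (intro cvx) auto
    have mK: "(\<lambda>x. min (m x) (u x)) \<in> K"
      using m0 u0 N_mono[of m "\<lambda>x. min (m x) (u x)"] Nm by (auto simp: K_def intro: order_trans)
    have "(LINT x|lebesgue. g x * g x) \<le> (LINT x|lebesgue. (u x - min (m x) (u x))\<^sup>2)"
      using lmin[OF mK] by (simp add: g_def power2_eq_square)
    also have "\<dots> \<le> (LINT x|lebesgue. g x * g x - 2 * t * (g x * (k x - l x)) + t\<^sup>2 * ((k x - l x) * (k x - l x)))"
    proof (rule integral_mono)
      have *: "\<bar>u x - min (m x) (u x)\<bar> \<le> M * indicator B x" for x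
        using m0[of x] u0[of x] uM[of x] by (auto simp: B_def min_def)
      show "integrable lebesgue (\<lambda>x. (u x - min (m x) (u x))\<^sup>2)"
        unfolding power2_eq_square by (rule bound_int; (rule *)?; measurable)
      fix x
      have "(u x - min (m x) (u x))\<^sup>2 \<le> (u x - m x)\<^sup>2" by (auto simp: min_def)
      also have "\<dots> = g x * g x - 2 * t * (g x * (k x - l x)) + t\<^sup>2 * ((k x - l x) * (k x - l x))"
        by (simp add: g_def m_def power2_eq_square algebra_simps)
      finally show "(u x - min (m x) (u x))\<^sup>2 \<le> \<dots>" .
    qed (use i1 in auto)
    also have "\<dots> = (LINT x|lebesgue. g x * g x) - 2 * t * P + t\<^sup>2 * S"
      using i1 by (simp add: P_def S_def)
    finally have "t * (2 * P) \<le> t * (t * S)" by (simp add: power2_eq_square algebra_simps)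
    then have "2 * P \<le> t * S" using t by simp
    then show False using t P by simp
  qed
  \<comment> \<open>Truncating at height \<open>j\<close> and restricting to \<open>B\<close>
    reduces to \<open>var\<close>; nothing is lost in the limit because \<open>g\<close> vanishes
    off \<open>B\<close>.\<close>
  have var': "(\<integral>\<^sup>+x. ennreal (g x * k x) \<partial>lebesgue) \<le> ennreal A"
    if [measurable]: "k \<in> meas_fun" and k0: "\<And>x. 0 \<le> k x" and Nk: "N k \<le> ennreal D" for k
  proof -
    define kj where "kj j x = min (k x) (real j) * indicator B x" for j x
    have [measurable]: "kj j \<in> meas_fun" for j unfolding kj_def by measurable
    have kj: "0 \<le> kj j x" "kj j x \<le> k x" "kj j x \<le> real j * indicator B x" for j x
      using k0 by (auto simp: kj_def indicator_def)
    have le: "(\<integral>\<^sup>+x. ennreal (g x * kj j x) \<partial>lebesgue) \<le> ennreal A" for j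
    proof -
      have "N (kj j) \<le> N k" using kj by (intro N_mono) auto
      then have "(LINT x|lebesgue. g x * kj j x) \<le> A"
        using kj Nk by (intro var[where j="real j"]) auto
      moreover have "integrable lebesgue (\<lambda>x. g x * kj j x)"
        by (rule bound_int[where m=M and m'="real j"]) (use gabs kj in auto)
      then have "(\<integral>\<^sup>+x. ennreal (g x * kj j x) \<partial>lebesgue) = ennreal (LINT x|lebesgue. g x * kj j x)"
        using g0 kj by (intro nn_integral_eq_integral) auto
      ultimately show ?thesis by (simp add: ennreal_leI)
    qed
    have "(\<integral>\<^sup>+x. ennreal (g x * k x) \<partial>lebesgue) = (\<integral>\<^sup>+x. (SUP j. ennreal (g x * kj j x)) \<partial>lebesgue)"
    proof (rule nn_integral_cong)
      fix x
      show "ennreal (g x * k x) = (SUP j. ennreal (g x * kj j x))"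
      proof (rule antisym)
        obtain j where "k x \<le> real j" using real_arch_simple by blast
        then have "g x * kj j x = g x * k x" using g_out[of x] by (cases "x \<in> B") (auto simp: kj_def)
        then show "ennreal (g x * k x) \<le> (SUP j. ennreal (g x * kj j x))"
          by (metis SUP_upper UNIV_I)
        show "(SUP j. ennreal (g x * kj j x)) \<le> ennreal (g x * k x)"
          using g0 kj by (intro SUP_least ennreal_leI mult_left_mono) auto
      qed
    qed
    also have "\<dots> = (SUP j. \<integral>\<^sup>+x. ennreal (g x * kj j x) \<partial>lebesgue)"
    proof (rule nn_integral_monotone_convergence_SUP)
      show "incseq (\<lambda>j x. ennreal (g x * kj j x))"
        using g0 by (intro incseq_SucI le_funI ennreal_leI mult_left_mono) (auto simp: kj_def indicator_def)
    qed measurable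
    also have "\<dots> \<le> ennreal A" by (rule SUP_least) (rule le)
    finally show ?thesis .
  qed
  \<comment> \<open>The associate norm tests with functions of norm 1, while \<open>var'\<close>
    allows norm \<open>D\<close>; rescaling by \<open>D\<close> produces the quotient.\<close>
  have "assoc_norm N g \<le> ennreal (A / D)"
    unfolding assoc_norm_def
  proof (rule SUP_least)
    fix v assume "v \<in> {g \<in> meas_fun. N g = 1}"
    then have [measurable]: "v \<in> meas_fun" and Nv: "N v = 1" by auto
    have "N (\<lambda>x. D * \<bar>v x\<bar>) \<le> ennreal D"
      using D Nv by (simp add: N_scale N_abs)
    then have "(\<integral>\<^sup>+x. ennreal (g x * (D * \<bar>v x\<bar>)) \<partial>lebesgue) \<le> ennreal A"
      using D by (intro var') auto
    then have "ennreal (1 / D) * (\<integral>\<^sup>+x. ennreal (g x * (D * \<bar>v x\<bar>)) \<partial>lebesgue) \<le> ennreal (1 / D) * ennreal A"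
      by (rule mult_left_mono) simp
    also have "ennreal (1 / D) * (\<integral>\<^sup>+x. ennreal (g x * (D * \<bar>v x\<bar>)) \<partial>lebesgue) = (\<integral>\<^sup>+x. ennreal (1 / D) * ennreal (g x * (D * \<bar>v x\<bar>)) \<partial>lebesgue)"
      by (rule nn_integral_cmult[symmetric]) measurable
    also have "\<dots> = (\<integral>\<^sup>+x. ennreal \<bar>g x * v x\<bar> \<partial>lebesgue)"
      using D g0 by (intro nn_integral_cong) (simp add: abs_mult field_simps flip: ennreal_mult)
    finally show "(\<integral>\<^sup>+x. ennreal \<bar>g x * v x\<bar> \<partial>lebesgue) \<le> ennreal (A / D)"
      using D A0 by (simp flip: ennreal_mult)
  qed
  \<comment> \<open>Apply \<open>dual\<close> to this \<open>g\<close>: the integral of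
    \<open>u * g\<close> is at most \<open>A\<close>, the integral of \<open>l * g\<close>. Since
    \<open>g = u - l\<close>, the integral of \<open>g * g\<close> cannot be positive, so
    \<open>u = l\<close> almost everywhere and \<open>u\<close> inherits the norm bound of
    \<open>l\<close>.\<close>
  then have "(\<integral>\<^sup>+x. ennreal (u x * \<bar>g x\<bar>) \<partial>lebesgue) \<le> ennreal D * ennreal (A / D)"
    by (intro order_trans[OF dual mult_left_mono]) auto
  also have "\<dots> = ennreal A" using D A0 by (simp flip: ennreal_mult)
  finally have ug: "(\<integral>\<^sup>+x. ennreal (u x * g x) \<partial>lebesgue) \<le> ennreal A" using g0 by simp
  have i2: "integrable lebesgue (\<lambda>x. u x * g x)" "integrable lebesgue (\<lambda>x. g x * l x)" "integrable lebesgue (\<lambda>x. g x * g x)"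
    by (rule bound_int[where m=M and m'=M]; use gabs u0 uM in \<open>auto simp: B_def\<close>)+
  have "(LINT x|lebesgue. u x * g x) \<le> A"
    using ug g0 u0 A0 by (subst (asm) nn_integral_eq_integral[OF i2(1)]) auto
  moreover have "(LINT x|lebesgue. g x * g x) = (LINT x|lebesgue. u x * g x) - A"
    unfolding A_def using i2 by (subst Bochner_Integration.integral_diff[symmetric]) (auto simp: g_def algebra_simps)
  moreover have "0 \<le> (LINT x|lebesgue. g x * g x)"
    by (intro integral_nonneg_AE) auto
  ultimately have "(LINT x|lebesgue. g x * g x) = 0" by simp
  then have "AE x in lebesgue. g x * g x = 0"
    using i2 by (subst (asm) integral_nonneg_eq_0_iff_AE) auto
  then have "AE x in lebesgue. \<bar>u x\<bar> \<le> \<bar>l x\<bar>"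
    by eventually_elim (simp add: g_def)
  then have "N u \<le> N l" by (intro N_mono_AE) auto
  then show ?thesis using Nl by simp
qed

end

section \<open>Norms of large balls and of functions decaying at infinity\<close>

lemma emeasure_lebesgue_ball_0:
  assumes "r \<ge> 0"
  shows "emeasure lebesgue (ball (0::'a::euclidean_space) r) = ennreal (r ^ DIM('a) * measure lebesgue (ball (0::'a) 1))"
proof -
  have "emeasure lebesgue (ball (0::'a) r) = ennreal (r ^ DIM('a)) * emeasure lebesgue (ball (0::'a) 1)"
    using assms by (rule emeasure_lebesgue_ball_conv_unit_ball)
  also have "emeasure lebesgue (ball (0::'a) 1) = ennreal (measure lebesgue (ball (0::'a) 1))"
    using emeasure_lborel_ball_finite[of "0::'a" 1] by (intro emeasure_eq_ennreal_measure) auto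
  finally show ?thesis using assms by (simp add: ennreal_mult)
qed

lemma nn_integral_le_maximal_op:
  fixes g :: "'a::euclidean_space \<Rightarrow> real"
  assumes "0 < r" "x \<in> ball c r"
  shows "(\<integral>\<^sup>+y\<in>ball c r. ennreal \<bar>g y\<bar> \<partial>lebesgue) / emeasure lebesgue (ball c r) \<le> maximal_op g x"
  unfolding maximal_op_def using assms by (intro SUP_upper2[of "(c, r)"]) auto

context ball_BFS_space
begin

lemma N_ball_eq_real: obtains b where "b > 0" "N (indicator (ball c 1)) = ennreal b"
proof -
  have "N (indicator (ball c 1)) \<noteq> top" using N_ball_finite[of c 1] by auto
  then obtain b where b: "b \<ge> 0" "N (indicator (ball c 1)) = ennreal b"
    by (cases "N (indicator (ball c 1))") auto
  moreover have "b > 0" using N_ball_pos[of 1 c] b by (cases "b = 0") auto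
  ultimately show thesis using that by blast
qed

text \<open>Testing the maximal function of g, which is at least the mean of \<open>\<bar>g\<bar>\<close> over a large ball,
  against the indicator of the unit ball.\<close>

lemma nn_integral_ball_le_assoc_norm:
  assumes mb: "maximal_bounded_on (assoc_norm N)"
  obtains C where "C > 0"
    "\<And>R g. R \<ge> 1 \<Longrightarrow> g \<in> meas_fun \<Longrightarrow>
      (\<integral>\<^sup>+x\<in>ball 0 R. ennreal \<bar>g x\<bar> \<partial>lebesgue) \<le> ennreal (C * R ^ DIM('a)) * assoc_norm N g"
proof -
  obtain C0 where C0: "\<And>f. f \<in> meas_fun \<Longrightarrow> assoc_norm N f < \<infinity> \<Longrightarrow>
      (AE x in lebesgue. maximal_op f x < \<infinity>)
      \<and> assoc_norm N (\<lambda>x. enn2real (maximal_op f x)) \<le> ennreal C0 * assoc_norm N f"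
    using mb unfolding maximal_bounded_on_def by auto
  \<comment> \<open>\<open>C0\<close> may be nonpositive; a positive constant is needed, in
    particular when the associate norm of \<open>g\<close> is infinite.\<close>
  define C1 where "C1 = max C0 1"
  obtain b where b: "b > 0" "N (indicator (ball 0 1)) = ennreal b"
    by (rule N_ball_eq_real)
  define m where "m = measure lebesgue (ball (0::'a) 1)"
  have m: "m > 0" using content_ball_pos[of 1 "0::'a"] by (simp add: m_def)
  have em: "emeasure lebesgue (ball (0::'a) 1) = ennreal m"
    using emeasure_lebesgue_ball_0[where r=1 and 'a='a] by (simp add: m_def)
  show thesis
  proof (rule that[of "C1 * b"])
    show "C1 * b > 0" using b by (simp add: C1_def)
    fix R :: real and g :: "'a \<Rightarrow> real"
    assume R: "R \<ge> 1" and g[measurable]: "g \<in> meas_fun"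
    define I where "I = (\<integral>\<^sup>+x\<in>ball 0 R. ennreal \<bar>g x\<bar> \<partial>lebesgue)"
    show "I \<le> ennreal (C1 * b * R ^ DIM('a)) * assoc_norm N g"
    proof (cases "assoc_norm N g = \<infinity>")
      case True
      then show ?thesis using b R by (simp add: C1_def ennreal_mult_top)
    next
      case False
      then have fin: "AE x in lebesgue. maximal_op g x < \<infinity>"
        and bd: "assoc_norm N (\<lambda>x. enn2real (maximal_op g x)) \<le> ennreal C0 * assoc_norm N g"
        using C0[OF g] by (auto simp: less_top)
      \<comment> \<open>The mean of \<open>\<bar>g\<bar>\<close> over \<open>ball 0 R\<close>. As
        \<open>R \<ge> 1\<close>, this ball contains the unit ball, so it is admissible in the
        maximal function at each point there.\<close>
      define a where "a = I / ennreal (R ^ DIM('a) * m)"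
      have a: "a \<le> maximal_op g x" if "x \<in> ball 0 1" for x
      proof -
        have eq: "ennreal (R ^ DIM('a) * m) = emeasure lebesgue (ball (0::'a) R)"
          unfolding m_def using R by (intro emeasure_lebesgue_ball_0[symmetric]) simp
        show ?thesis
          unfolding a_def I_def eq by (rule nn_integral_le_maximal_op) (use that R in auto)
      qed
      \<comment> \<open>The indicator of the unit ball, normalised so that it is admissible in the
        supremum defining the associate norm.\<close>
      define v :: "'a \<Rightarrow> real" where "v x = (1 / b) * indicator (ball 0 1) x" for x
      have vm: "v \<in> meas_fun" unfolding v_def by measurable
      have Nv: "N v = 1"
        using b N_scale[OF ball_meas, of "1 / b" 0 1] by (simp add: v_def[abs_def] flip: ennreal_mult)
      have "a * ennreal (m / b) = (\<integral>\<^sup>+x. (a * ennreal (1 / b)) * indicator (ball (0::'a) 1) x \<partial>lebesgue)"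
        using b m by (subst nn_integral_cmult_indicator) (auto simp: em mult.assoc simp flip: ennreal_mult)
      also have "\<dots> \<le> (\<integral>\<^sup>+x. ennreal \<bar>enn2real (maximal_op g x) * v x\<bar> \<partial>lebesgue)"
      proof (rule nn_integral_mono_AE, use fin in eventually_elim)
        case (elim x)
        show ?case
        proof (cases "x \<in> ball 0 1")
          case True
          have "a * ennreal (1 / b) \<le> ennreal (enn2real (maximal_op g x)) * ennreal (1 / b)"
            using a[OF True] elim by (intro mult_right_mono) (auto simp: less_top)
          also have "\<dots> = ennreal \<bar>enn2real (maximal_op g x) * v x\<bar>"
            using True b by (simp add: v_def abs_mult flip: ennreal_mult)
          finally show ?thesis using True by simp
        qed simp
      qed
      also have "\<dots> \<le> assoc_norm N (\<lambda>x. enn2real (maximal_op g x))"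
        unfolding assoc_norm_def by (rule SUP_upper) (use vm Nv in auto)
      also note bd
      also have "ennreal C0 * assoc_norm N g \<le> ennreal C1 * assoc_norm N g"
        by (intro mult_right_mono ennreal_leI) (auto simp: C1_def)
      finally have *: "a * ennreal (m / b) \<le> ennreal C1 * assoc_norm N g" .
      have "I = a * ennreal (R ^ DIM('a) * m)"
        unfolding a_def using R m by (simp add: ennreal_divide_times)
      also have "\<dots> = a * ennreal (m / b) * ennreal (b * R ^ DIM('a))"
        using b m R by (simp add: mult.assoc field_simps flip: ennreal_mult)
      also have "\<dots> \<le> ennreal C1 * assoc_norm N g * ennreal (b * R ^ DIM('a))"
        by (rule mult_right_mono[OF *]) simp
      also have "\<dots> = ennreal (C1 * (b * R ^ DIM('a))) * assoc_norm N g"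
        using b R by (subst ennreal_mult) (auto simp: C1_def ac_simps)
      finally show ?thesis by (simp add: mult.assoc)
    qed
  qed
qed

text \<open>The preceding estimate is precisely the dual hypothesis of
  \<open>N_le_by_duality\<close> for the indicator of the ball. The power of \<open>R\<close> is the
  volume factor of the mean.\<close>

lemma N_ball_growth:
  assumes mb: "maximal_bounded_on (assoc_norm N)"
  obtains C where "C > 0" "\<And>R. R \<ge> 1 \<Longrightarrow> N (indicator (ball 0 R)) \<le> ennreal (C * R ^ DIM('a))"
proof -
  obtain C where C: "C > 0" "\<And>R g. R \<ge> 1 \<Longrightarrow> g \<in> meas_fun \<Longrightarrow>
      (\<integral>\<^sup>+x\<in>ball 0 R. ennreal \<bar>g x\<bar> \<partial>lebesgue) \<le> ennreal (C * R ^ DIM('a)) * assoc_norm N g"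
    using nn_integral_ball_le_assoc_norm[OF mb] by blast
  show thesis
  proof (rule that[OF C(1)])
    fix R :: real assume R: "R \<ge> 1"
    show "N (indicator (ball 0 R)) \<le> ennreal (C * R ^ DIM('a))"
    proof (rule N_le_by_duality[where M=1 and c=0 and r=R])
      fix g :: "'a \<Rightarrow> real" assume "g \<in> meas_fun"
      have "(\<integral>\<^sup>+x. ennreal (indicator (ball 0 R) x * \<bar>g x\<bar>) \<partial>lebesgue) = (\<integral>\<^sup>+x\<in>ball 0 R. ennreal \<bar>g x\<bar> \<partial>lebesgue)"
        by (rule nn_integral_cong) (simp add: indicator_def)
      then show "(\<integral>\<^sup>+x. ennreal (indicator (ball 0 R) x * \<bar>g x\<bar>) \<partial>lebesgue) \<le> ennreal (C * R ^ DIM('a)) * assoc_norm N g"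
        using C(2)[OF R \<open>g \<in> meas_fun\<close>] by simp
    qed (use C R in \<open>auto simp: ball_meas\<close>)
  qed
qed

text \<open>Dyadic shells: where \<open>2^k \<le> norm x < 2^(k+1)\<close> the function is at most
  \<open>2 powr (- s * k)\<close>, and the ball containing the shell has norm O(2^(k n)). The norms
  of the shells are thus dominated by a geometric series of ratio \<open>2 powr (n - s) < 1\<close>,
  and the partial sums pass to the limit by monotone convergence.\<close>

lemma N_power_decay_finite:
  assumes mb: "maximal_bounded_on (assoc_norm N)" and s: "s > real DIM('a)"
  shows "N (\<lambda>x. norm x powr - s * indicator (- ball 0 1) x) < \<infinity>"
proof -
  let ?n = "DIM('a)"
  obtain C where C: "C > 0" "\<And>R. R \<ge> 1 \<Longrightarrow> N (indicator (ball 0 R)) \<le> ennreal (C * R ^ ?n)"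
    using N_ball_growth[OF mb] by blast
  define F where "F k x = norm x powr - s * indicator (ball 0 (2 ^ k) - ball 0 1) x" for k :: nat and x :: 'a
  define f where "f x = norm x powr - s * indicator (- ball 0 1) x" for x :: 'a
  have m[measurable]: "ball (0::'a) r \<in> sets borel" for r by simp
  have [measurable]: "F k \<in> meas_fun" "f \<in> meas_fun" for k
    unfolding F_def f_def by (rule measurable_completion; measurable)+
  define a where "a = (2::real) powr (real ?n - s)"
  have a: "0 < a" "a < 1" using s powr_less_mono[of "real ?n - s" 0 2] by (auto simp: a_def)
  have FS: "F (Suc k) x \<le> F k x + 2 powr (- s * real k) * indicator (ball 0 (2 ^ Suc k)) x" for k x
  proof (cases "2 ^ k \<le> norm x \<and> norm x < 2 ^ Suc k")
    case True
    have "norm x powr - s \<le> (2 ^ k) powr - s"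
      using True s by (intro powr_mono2') (auto intro: less_le_trans[of 0 "real ?n"])
    also have "\<dots> = 2 powr (- s * real k)"
      by (simp add: powr_powr mult.commute flip: powr_realpow)
    finally show ?thesis using True by (simp add: F_def indicator_def)
  next
    case False
    then show ?thesis by (auto simp: F_def indicator_def)
  qed
  have NF: "N (F k) \<le> ennreal (C * 2 ^ ?n * (\<Sum>j<k. a ^ j))" for k
  proof (induction k)
    case 0
    have "F 0 = (\<lambda>x. 0)" by (auto simp: F_def)
    then show ?case by (simp add: N_0)
  next
    case (Suc k)
    have "N (F (Suc k)) \<le> N (\<lambda>x. F k x + 2 powr (- s * real k) * indicator (ball 0 (2 ^ Suc k)) x)"
      proof (rule N_mono)
      show "(\<lambda>x. F k x + 2 powr (- s * real k) * indicator (ball 0 (2 ^ Suc k)) x) \<in> meas_fun"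
        by measurable
    qed (rule FS | simp add: F_def)+
    also have "\<dots> \<le> N (F k) + N (\<lambda>x. 2 powr (- s * real k) * indicator (ball 0 (2 ^ Suc k)) x)"
      by (rule N_triangle) auto
    also have "N (\<lambda>x. 2 powr (- s * real k) * indicator (ball 0 (2 ^ Suc k)) x) = ennreal (2 powr (- s * real k)) * N (indicator (ball 0 (2 ^ Suc k)))"
      by (simp add: N_scale ball_meas del: power_Suc)
    also have "\<dots> \<le> ennreal (2 powr (- s * real k)) * ennreal (C * (2 ^ Suc k) ^ ?n)"
      by (intro mult_left_mono C(2)) (auto intro: one_le_power simp del: power_Suc)
    also have "\<dots> = ennreal (C * 2 ^ ?n * a ^ k)"
    proof -
      have "a ^ k = 2 powr (real k * real ?n) * 2 powr (- s * real k)"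
        by (simp add: a_def powr_powr algebra_simps flip: powr_realpow powr_add)
      also have "(2::real) powr (real k * real ?n) = (2 ^ k) ^ ?n"
        by (simp add: powr_powr flip: powr_realpow)
      finally show ?thesis using C(1) by (simp add: power_mult_distrib ac_simps flip: ennreal_mult)
    qed
    also have "N (F k) + ennreal (C * 2 ^ ?n * a ^ k) \<le> ennreal (C * 2 ^ ?n * (\<Sum>j<k. a ^ j)) + ennreal (C * 2 ^ ?n * a ^ k)"
      by (rule add_right_mono[OF Suc])
    also have "\<dots> = ennreal (C * 2 ^ ?n * (\<Sum>j<Suc k. a ^ j))"
      using C(1) a by (subst ennreal_plus[symmetric]) (auto simp: algebra_simps intro!: mult_nonneg_nonneg sum_nonneg)
    finally show ?case by simp
  qed
  have "(\<lambda>k. N (F k)) \<longlonglongrightarrow> N f"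
  proof (rule N_mono_conv)
    show "F k x \<le> F (Suc k) x" for k x
      by (auto simp: F_def indicator_def intro: less_le_trans)
    show "AE x in lebesgue. (\<lambda>k. F k x) \<longlonglongrightarrow> f x"
    proof (rule AE_I2, rule tendsto_eventually)
      fix x :: 'a
      obtain K where K: "norm x < 2 ^ K" using real_arch_pow[of 2 "norm x"] by auto
      have "F k x = f x" if "k \<ge> K" for k
      proof -
        have "norm x < 2 ^ k" using less_le_trans[OF K power_increasing[OF that]] by simp
        then show ?thesis by (simp add: F_def f_def indicator_def)
      qed
      then show "\<forall>\<^sub>F k in sequentially. F k x = f x" unfolding eventually_sequentially by blast
    qed
  qed (auto simp: F_def)
  moreover have "N (F k) \<le> ennreal (C * 2 ^ ?n * (1 / (1 - a)))" for k
  proof -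
    have "(\<Sum>j<k. a ^ j) \<le> (\<Sum>j. a ^ j)" using a by (intro sum_le_suminf summable_geometric) auto
    also have "\<dots> = 1 / (1 - a)" using a by (intro suminf_geometric) auto
    finally show ?thesis using C(1) by (intro order_trans[OF NF] ennreal_leI mult_left_mono) auto
  qed
  ultimately have "N f \<le> ennreal (C * 2 ^ ?n * (1 / (1 - a)))"
    by (intro LIMSEQ_le_const2) auto
  then show ?thesis unfolding f_def by (simp add: order_le_less_trans)
qed

end

text \<open>The norm of \<open>|x| powr - (s * p)\<close> in the convexified space is the p-th power
  of the norm of \<open>|x| powr - s\<close> in X, and such a power is infinite only when its base
  is.\<close>

lemma power_decay_finite_of_convexify:
  fixes N :: "('a::euclidean_space \<Rightarrow> real) \<Rightarrow> ennreal"
  assumes p: "p > 0" and Y: "ball_BFS (convexify N (1 / p))"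
    and mb: "maximal_bounded_on (assoc_norm (convexify N (1 / p)))" and s: "s * p > real DIM('a)"
  shows "N (\<lambda>x. norm x powr - s * indicator (- ball 0 1) x) < \<infinity>"
proof -
  interpret Y: ball_BFS_space "convexify N (1 / p)" by unfold_locales fact
  have eq: "\<bar>norm x powr - (s * p) * indicator (- ball 0 1) x\<bar> powr (1 / p) = norm x powr - s * indicator (- ball 0 1) x" for x :: 'a
    using p by (simp add: indicator_def powr_powr)
  have "convexify N (1 / p) (\<lambda>x. norm x powr - (s * p) * indicator (- ball 0 1) x) < \<infinity>"
    by (rule Y.N_power_decay_finite[OF mb s])
  then show ?thesis
    unfolding convexify_def eq by (auto simp: enn_powr_def less_top split: if_splits)
qed

subsection \<open>Polar coordinates and rotation invariance\<close>

lemma nn_integral_lborel_translate: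
  fixes f :: "'a::euclidean_space \<Rightarrow> ennreal"
  assumes [measurable]: "f \<in> borel_measurable borel"
  shows "(\<integral>\<^sup>+x. f (c + x) \<partial>lborel) = (\<integral>\<^sup>+x. f x \<partial>lborel)"
  by (subst (2) lborel_distr_plus[of c, symmetric]) (simp add: nn_integral_distr)

lemma nn_integral_lborel_scale:
  fixes f :: "'a::euclidean_space \<Rightarrow> ennreal"
  assumes [measurable]: "f \<in> borel_measurable borel" and c: "c > 0"
  shows "(\<integral>\<^sup>+x. f x \<partial>lborel) = ennreal (c ^ DIM('a)) * (\<integral>\<^sup>+x. f (c *\<^sub>R x) \<partial>lborel)"
  using c by (subst lborel_affine[of c 0])
     (simp_all add: nn_integral_density nn_integral_distr nn_integral_cmult)

lemma nn_integral_powr_at_least: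
  fixes a e :: real
  assumes "e < -1" "a > 0"
  shows "(\<integral>\<^sup>+t\<in>{a<..}. ennreal (t powr e) \<partial>lborel) = ennreal (- (a powr (e + 1)) / (e + 1))"
proof -
  have "(\<integral>\<^sup>+t\<in>{a<..}. ennreal (t powr e) \<partial>lborel) = (\<integral>\<^sup>+t\<in>{a..}. ennreal (t powr e) \<partial>lborel)"
    by (rule nn_integral_cong_AE, rule AE_mp[OF AE_lborel_singleton[of a]])
       (auto simp: indicator_def)
  also have "\<dots> = ennreal (- (a powr (e + 1)) / (e + 1))"
    by (rule nn_integral_has_integral_lebesgue'[OF _ has_integral_powr_to_inf[OF assms]]) auto
  finally show ?thesis .
qed

lemma nn_integral_powr_from_0:
  fixes a c :: real
  assumes "a > -1" "c \<ge> 0"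
  shows "(\<integral>\<^sup>+t\<in>{0<..<c}. ennreal (t powr a) \<partial>lborel) = ennreal (c powr (a + 1) / (a + 1))"
proof -
  have "(\<integral>\<^sup>+t\<in>{0<..<c}. ennreal (t powr a) \<partial>lborel) = (\<integral>\<^sup>+t\<in>{0..c}. ennreal (t powr a) \<partial>lborel)"
    by (rule nn_integral_cong_AE, rule AE_mp[OF AE_lborel_singleton[of 0]],
        rule AE_mp[OF AE_lborel_singleton[of c]])
       (auto simp: indicator_def)
  also have "\<dots> = ennreal (c powr (a + 1) / (a + 1))"
    by (rule nn_integral_has_integral_lebesgue'[OF _ has_integral_powr_from_0[OF assms]]) auto
  finally show ?thesis .
qed

text \<open>Substitute \<open>r = |z| t\<close> in the inner integral, exchange the order of integration and rescale
  \<open>z\<close> by \<open>t\<close>; the remaining integral over \<open>t > |u|\<close> is explicit.\<close>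

lemma nn_integral_polar:
  fixes F :: "'a::euclidean_space \<Rightarrow> ennreal"
  assumes [measurable]: "F \<in> borel_measurable borel"
  shows "(\<integral>\<^sup>+x. F x \<partial>lborel) = ennreal (real DIM('a)) * (\<integral>\<^sup>+z\<in>ball 0 1.
    (\<integral>\<^sup>+r\<in>{0<..}. F ((r / norm z) *\<^sub>R z) * ennreal (r ^ (DIM('a) - 1)) \<partial>lborel) \<partial>lborel)"
proof -
  let ?n = "DIM('a)"
  have n: "?n > 0" by simp
  define J where "J z = (\<integral>\<^sup>+r\<in>{0<..}. F ((r / norm z) *\<^sub>R z) * ennreal (r ^ (?n - 1)) \<partial>lborel)" for z
  \<comment> \<open>\<open>H\<close> is the integrand after \<open>r = |z| t\<close>, where
    \<open>r^(n-1) dr\<close> turns into \<open>|z|^n t^(n-1) dt\<close>. \<open>K\<close> is what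
    remains after \<open>u = t z\<close>: the Jacobian \<open>t^-n\<close> gives
    \<open>|u|^n t^(-n-1)\<close>, and \<open>|z| < 1\<close> turns into
    \<open>|u| < t\<close>.\<close>
  define H where "H z t = indicator (ball 0 1) z * (indicator {0<..} t * (F (t *\<^sub>R z) * ennreal (norm z ^ ?n * t ^ (?n - 1))))"
    for z :: 'a and t :: real
  define K where "K u t = indicator {norm u<..} t * (F u * ennreal (norm u ^ ?n * t powr (- real ?n - 1)))"
    for u :: 'a and t :: real
  have Halt: "H = (\<lambda>z t. if norm z < 1 \<and> 0 < t then F (t *\<^sub>R z) * ennreal (norm z ^ ?n * t ^ (?n - 1)) else 0)"
    by (auto simp: H_def fun_eq_iff)
  have [measurable]: "case_prod H \<in> borel_measurable (lborel \<Otimes>\<^sub>M lborel)"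
    unfolding Halt by measurable
  have Kalt: "K = (\<lambda>u t. (if norm u < t then F u * ennreal (norm u ^ ?n * t powr (- real ?n - 1)) else 0))"
    by (auto simp: K_def fun_eq_iff)
  have [measurable]: "case_prod K \<in> borel_measurable (lborel \<Otimes>\<^sub>M lborel)"
    unfolding Kalt by measurable
  have J: "J z * indicator (ball 0 1) z = (\<integral>\<^sup>+t. H z t \<partial>lborel)" if "z \<noteq> 0" for z
  proof -
    have nz: "norm z > 0" using that by simp
    have "J z = ennreal \<bar>norm z\<bar> * (\<integral>\<^sup>+t. F (((0 + norm z * t) / norm z) *\<^sub>R z) * ennreal ((0 + norm z * t) ^ (?n - 1)) * indicator {0<..} (0 + norm z * t) \<partial>lborel)"
      unfolding J_def using nz by (intro nn_integral_real_affine) auto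
    also have "\<dots> = (\<integral>\<^sup>+t. ennreal (norm z) * (F (((0 + norm z * t) / norm z) *\<^sub>R z) * ennreal ((0 + norm z * t) ^ (?n - 1)) * indicator {0<..} (0 + norm z * t)) \<partial>lborel)"
      using nz by (subst nn_integral_cmult) (auto simp del: times_divide_eq_left)
    also have "\<dots> = (\<integral>\<^sup>+t. indicator {0<..} t * (F (t *\<^sub>R z) * ennreal (norm z ^ ?n * t ^ (?n - 1))) \<partial>lborel)"
    proof (rule nn_integral_cong)
      fix t :: real
      have "norm z ^ ?n = norm z * norm z ^ (?n - 1)"
        using n by (metis power_eq_if not_gr_zero)
      then show "ennreal (norm z) * (F (((0 + norm z * t) / norm z) *\<^sub>R z) * ennreal ((0 + norm z * t) ^ (?n - 1)) * indicator {0<..} (0 + norm z * t))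
        = indicator {0<..} t * (F (t *\<^sub>R z) * ennreal (norm z ^ ?n * t ^ (?n - 1)))"
        using nz by (auto simp: indicator_def zero_less_mult_iff power_mult_distrib ennreal_mult' ac_simps)
    qed
    finally show ?thesis
      by (simp add: H_def indicator_def)
  qed
  have HK: "(\<integral>\<^sup>+z. H z t \<partial>lborel) = (\<integral>\<^sup>+u. K u t \<partial>lborel)" for t
  proof (cases "t > 0")
    case True
    have "(\<integral>\<^sup>+u. K u t \<partial>lborel) = ennreal (t ^ ?n) * (\<integral>\<^sup>+z. K (t *\<^sub>R z) t \<partial>lborel)"
      using True by (intro nn_integral_lborel_scale) simp_all
    also have "\<dots> = (\<integral>\<^sup>+z. ennreal (t ^ ?n) * K (t *\<^sub>R z) t \<partial>lborel)"
      by (subst nn_integral_cmult) auto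
    also have "\<dots> = (\<integral>\<^sup>+z. H z t \<partial>lborel)"
    proof (rule nn_integral_cong)
      fix z :: 'a
      have "t powr (- real ?n - 1) = inverse (t ^ ?n * t)"
        using True by (simp add: powr_diff powr_minus powr_realpow field_simps)
      then have "t ^ ?n * ((t * norm z) ^ ?n * t powr (- real ?n - 1)) = norm z ^ ?n * (t ^ ?n / t)"
        using True by (simp add: field_simps power_mult_distrib)
      also have "t ^ ?n / t = t ^ (?n - 1)"
        using True n by (simp add: power_diff)
      finally have "ennreal (t ^ ?n) * ennreal ((t * norm z) ^ ?n * t powr (- real ?n - 1)) = ennreal (norm z ^ ?n * t ^ (?n - 1))"
        using True by (simp flip: ennreal_mult)
      then show "ennreal (t ^ ?n) * K (t *\<^sub>R z) t = H z t"
        using True by (auto simp: K_def H_def indicator_def ac_simps)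
    qed
    finally show ?thesis by simp
  next
    case False
    have "\<not> norm u < t" for u :: 'a
      using False by (meson norm_ge_zero order.strict_trans1)
    then show ?thesis using False by (simp add: H_def Kalt)
  qed
  have "(\<integral>\<^sup>+z\<in>ball 0 1. J z \<partial>lborel) = (\<integral>\<^sup>+z. (\<integral>\<^sup>+t. H z t \<partial>lborel) \<partial>lborel)"
    by (rule nn_integral_cong_AE, rule AE_mp[OF AE_lborel_singleton[of 0]]) (auto simp: J)
  also have "\<dots> = (\<integral>\<^sup>+t. (\<integral>\<^sup>+z. H z t \<partial>lborel) \<partial>lborel)"
    by (rule lborel_pair.Fubini'[symmetric]) simp
  also have "\<dots> = (\<integral>\<^sup>+t. (\<integral>\<^sup>+u. K u t \<partial>lborel) \<partial>lborel)"
    by (simp add: HK)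
  also have "\<dots> = (\<integral>\<^sup>+u. (\<integral>\<^sup>+t. K u t \<partial>lborel) \<partial>lborel)"
    by (rule lborel_pair.Fubini') simp
  \<comment> \<open>For \<open>u \<noteq> 0\<close> the integral of \<open>|u|^n t^(-n-1)\<close>
    over \<open>t > |u|\<close> is 1/n, which cancels the prefactor n of the claim. At the origin
    \<open>|u|^n\<close> vanishes and the identity may fail, so this null set is discarded.\<close>
  also have "\<dots> = (\<integral>\<^sup>+u. ennreal (1 / real ?n) * F u \<partial>lborel)"
  proof (rule nn_integral_cong_AE, rule AE_mp[OF AE_lborel_singleton[of 0]], rule AE_I2, intro impI)
    fix u :: 'a assume "u \<noteq> 0"
    then have u: "norm u > 0" by simp
    have "(\<integral>\<^sup>+t. K u t \<partial>lborel) = (\<integral>\<^sup>+t. (F u * ennreal (norm u ^ ?n)) * (ennreal (t powr (- real ?n - 1)) * indicator {norm u<..} t) \<partial>lborel)"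
      by (rule nn_integral_cong) (auto simp: K_def ennreal_mult' ac_simps)
    also have "\<dots> = (F u * ennreal (norm u ^ ?n)) * ennreal (- (norm u powr (- real ?n - 1 + 1)) / (- real ?n - 1 + 1))"
      using u n by (subst nn_integral_cmult, simp, subst nn_integral_powr_at_least) auto
    also have "\<dots> = F u * ennreal (norm u ^ ?n * (norm u powr (- real ?n) / real ?n))"
      by (subst ennreal_mult) (auto simp: mult.assoc)
    also have "norm u ^ ?n * (norm u powr (- real ?n) / real ?n) = 1 / real ?n"
      using u by (simp add: powr_minus powr_realpow field_simps)
    finally show "(\<integral>\<^sup>+t. K u t \<partial>lborel) = ennreal (1 / real ?n) * F u"
      by (simp add: ac_simps)
  qed
  also have "\<dots> = ennreal (1 / real ?n) * (\<integral>\<^sup>+u. F u \<partial>lborel)"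
    by (rule nn_integral_cmult) simp
  finally have "ennreal (real ?n) * (\<integral>\<^sup>+z\<in>ball 0 1. J z \<partial>lborel) = ennreal (real ?n) * (ennreal (1 / real ?n) * (\<integral>\<^sup>+u. F u \<partial>lborel))"
    by simp
  also have "\<dots> = ennreal (real ?n * (1 / real ?n)) * (\<integral>\<^sup>+u. F u \<partial>lborel)"
    by (subst ennreal_mult) (auto simp: mult.assoc)
  also have "real ?n * (1 / real ?n) = 1" using n by simp
  finally show ?thesis by (simp add: J_def)
qed

text \<open>Uniqueness of Haar measure: integrate \<open>g (T x + y)\<close> against the indicator of the unit ball
  in \<open>y\<close> and use that this ball is invariant under \<open>T\<close>.\<close>

lemma nn_integral_linear_isometry:
  fixes T S :: "'a::euclidean_space \<Rightarrow> 'a" and g :: "'a \<Rightarrow> ennreal"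
  assumes g[measurable]: "g \<in> borel_measurable borel"
    and T: "linear T" and iso: "\<And>x. norm (T x) = norm x" and inv: "\<And>y. T (S y) = y"
  shows "(\<integral>\<^sup>+x. g (T x) \<partial>lborel) = (\<integral>\<^sup>+x. g x \<partial>lborel)"
proof -
  interpret linear T by fact
  have [measurable]: "T \<in> borel_measurable borel"
    using T by (intro borel_measurable_continuous_onI linear_continuous_on) (simp add: linear_conv_bounded_linear)
  have [measurable]: "ball (0::'a) 1 \<in> sets borel" by simp
  define B where "B = emeasure lborel (ball (0::'a) 1)"
  have B: "B \<noteq> 0" "B \<noteq> \<infinity>"
    using emeasure_lborel_ball_finite[of "0::'a" 1] content_ball_pos[of 1 "0::'a"]
    by (auto simp: B_def measure_def)
  have "(\<integral>\<^sup>+x. g (T x) \<partial>lborel) * B = (\<integral>\<^sup>+y. (\<integral>\<^sup>+x. g (T x) \<partial>lborel) * indicator (ball (0::'a) 1) y \<partial>lborel)"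
    unfolding B_def by (rule nn_integral_cmult_indicator[symmetric]) simp
  also have "\<dots> = (\<integral>\<^sup>+y. (\<integral>\<^sup>+x. g (T x + y) * indicator (ball 0 1) y \<partial>lborel) \<partial>lborel)"
  proof (rule nn_integral_cong)
    fix y :: 'a
    \<comment> \<open>Shifting x by \<open>S y\<close> shifts \<open>T x\<close> by y, so y is
      introduced without changing the value.\<close>
    have "(\<integral>\<^sup>+x. g (T x) \<partial>lborel) = (\<integral>\<^sup>+x. g (T (S y + x)) \<partial>lborel)"
      by (rule nn_integral_lborel_translate[symmetric]) simp
    also have "\<dots> = (\<integral>\<^sup>+x. g (T x + y) \<partial>lborel)"
      by (simp add: add inv add.commute)
    finally show "(\<integral>\<^sup>+x. g (T x) \<partial>lborel) * indicator (ball 0 1) y = (\<integral>\<^sup>+x. g (T x + y) * indicator (ball 0 1) y \<partial>lborel)"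
      by (subst nn_integral_multc) auto
  qed
  also have "\<dots> = (\<integral>\<^sup>+x. (\<integral>\<^sup>+y. g (T x + y) * indicator (ball 0 1) y \<partial>lborel) \<partial>lborel)"
    by (rule lborel_pair.Fubini') measurable
  also have "\<dots> = (\<integral>\<^sup>+x. (\<integral>\<^sup>+y. g y * indicator (ball 0 1) (y - T x) \<partial>lborel) \<partial>lborel)"
  proof (rule nn_integral_cong)
    fix x :: 'a
    show "(\<integral>\<^sup>+y. g (T x + y) * indicator (ball 0 1) y \<partial>lborel) = (\<integral>\<^sup>+y. g y * indicator (ball 0 1) (y - T x) \<partial>lborel)"
      using nn_integral_lborel_translate[of "\<lambda>y. g y * indicator (ball 0 1) (y - T x)" "T x"]
      by simp
  qed
  also have "\<dots> = (\<integral>\<^sup>+y. (\<integral>\<^sup>+x. g y * indicator (ball 0 1) (y - T x) \<partial>lborel) \<partial>lborel)"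
    by (rule lborel_pair.Fubini') measurable
  also have "\<dots> = (\<integral>\<^sup>+y. g y * B \<partial>lborel)"
  proof (rule nn_integral_cong)
    fix y :: 'a
    have "norm (y - T x) = norm (x - S y)" for x
      by (metis diff iso inv norm_minus_commute)
    then have "(\<integral>\<^sup>+x. g y * indicator (ball 0 1) (y - T x) \<partial>lborel) = (\<integral>\<^sup>+x. g y * indicator (ball (0::'a) 1) (- S y + x) \<partial>lborel)"
      by (intro nn_integral_cong) (auto simp: indicator_def)
    also have "\<dots> = (\<integral>\<^sup>+x. g y * indicator (ball (0::'a) 1) x \<partial>lborel)"
      by (rule nn_integral_lborel_translate) simp
    also have "\<dots> = g y * B"
      by (simp add: nn_integral_cmult B_def)
    finally show "(\<integral>\<^sup>+x. g y * indicator (ball 0 1) (y - T x) \<partial>lborel) = g y * B" .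
  qed
  also have "\<dots> = (\<integral>\<^sup>+y. g y \<partial>lborel) * B"
    by (rule nn_integral_multc) simp
  finally have "(\<integral>\<^sup>+x. g (T x) \<partial>lborel) * B / B = (\<integral>\<^sup>+x. g x \<partial>lborel) * B / B"
    by (rule arg_cong)
  then show ?thesis
    using B by (simp add: mult_divide_eq_ennreal)
qed

section \<open>Weighted measure of homogeneous sections and the constant kappa\<close>

lemma powr_less_powr_iff_pos:
  fixes x y c :: real
  assumes "x > 0" "y > 0" "c > 0"
  shows "x powr c < y powr c \<longleftrightarrow> x < y"
  using assms powr_less_mono2[of c x y] powr_less_mono2[of c y x]
  by (cases x y rule: linorder_cases) auto

lemma powr_less_powr_iff_neg:
  fixes x y c :: real
  assumes "x > 0" "y > 0" "c < 0"
  shows "x powr c < y powr c \<longleftrightarrow> y < x"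
  using assms powr_less_mono2_neg[of c x y] powr_less_mono2_neg[of c y x]
  by (cases x y rule: linorder_cases) auto

text \<open>On each ray \<open>h\<close> is constant, so the section is \<open>r < R\<close> for
  \<gamma> > 0 and \<open>r > R\<close> for \<gamma> < 0, where
  \<open>R powr (\<gamma> / q) = h z / t\<close>. In polar coordinates the weight is
  \<open>r powr (\<gamma> - 1)\<close>, whose integral over either interval is
  \<open>R powr \<gamma> / \<bar>\<gamma>\<bar>\<close>. Hence one formula serves both
  signs.\<close>

lemma nn_integral_homogeneous_section:
  fixes h :: "'a::euclidean_space \<Rightarrow> real"
  assumes [measurable]: "h \<in> borel_measurable borel"
    and hom: "\<And>c z. c > 0 \<Longrightarrow> h (c *\<^sub>R z) = h z" and pos: "\<And>z. h z > 0"
    and t: "t > 0" and q: "q > 0" and \<gamma>: "\<gamma> \<noteq> 0"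
  shows "(\<integral>\<^sup>+z\<in>{z. z \<noteq> 0 \<and> t * norm z powr (\<gamma> / q) < h z}. ennreal (norm z powr (\<gamma> - real DIM('a))) \<partial>lborel)
    = ennreal (real DIM('a) / \<bar>\<gamma>\<bar>) * (\<integral>\<^sup>+z\<in>ball 0 1. ennreal ((h z / t) powr q) \<partial>lborel)"
proof -
  let ?n = "DIM('a)"
  have [measurable]: "ball (0::'a) 1 \<in> sets borel" by simp
  define F where "F z = ennreal (norm z powr (\<gamma> - real ?n)) * indicator {z. z \<noteq> 0 \<and> t * norm z powr (\<gamma> / q) < h z} z" for z :: 'a
  have [measurable]: "F \<in> borel_measurable borel"
    unfolding F_def by measurable
  have inner: "(\<integral>\<^sup>+r\<in>{0<..}. F ((r / norm z) *\<^sub>R z) * ennreal (r ^ (?n - 1)) \<partial>lborel)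
     = ennreal (1 / \<bar>\<gamma>\<bar>) * ennreal ((h z / t) powr q)" if z: "z \<noteq> 0" for z
  proof -
    define R where "R = (h z / t) powr (q / \<gamma>)"
    have R: "R > 0" "R powr (\<gamma> / q) = h z / t" "R powr \<gamma> = (h z / t) powr q"
      using pos[of z] t q \<gamma> by (auto simp: R_def powr_powr)
    define I where "I = (if \<gamma> > 0 then {0<..<R} else {R<..})"
    have eq: "F ((r / norm z) *\<^sub>R z) * ennreal (r ^ (?n - 1)) * indicator {0<..} r = ennreal (r powr (\<gamma> - 1)) * indicator I r" for r
    proof (cases "r > 0")
      case True
      have "t * r powr (\<gamma> / q) < h z \<longleftrightarrow> r powr (\<gamma> / q) < R powr (\<gamma> / q)"
        using t by (simp add: R field_simps)
      also have "\<dots> \<longleftrightarrow> r \<in> I"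
      proof (cases "\<gamma> > 0")
        case g: True
        then have "\<gamma> / q > 0" using q by simp
        with True R(1) g show ?thesis
          by (simp add: I_def powr_less_powr_iff_pos)
      next
        case g: False
        then have "\<gamma> / q < 0" using q \<gamma> by (simp add: field_simps)
        with True R(1) g show ?thesis
          by (simp add: I_def powr_less_powr_iff_neg)
      qed
      finally have *: "t * r powr (\<gamma> / q) < h z \<longleftrightarrow> r \<in> I" .
      have "real (?n - 1) = real ?n - 1" by (simp add: of_nat_diff Suc_leI)
      then have "r ^ (?n - 1) = r powr (real ?n - 1)"
        using True by (metis powr_realpow)
      then have "r powr (\<gamma> - real ?n) * r ^ (?n - 1) = r powr (\<gamma> - 1)"
        by (simp flip: powr_add)
      then show ?thesis
        using True z * hom[of "r / norm z" z] by (auto simp: F_def indicator_def simp flip: ennreal_mult)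
    next
      case False
      then show ?thesis using R(1) by (auto simp: I_def)
    qed
    have "(\<integral>\<^sup>+r\<in>{0<..}. F ((r / norm z) *\<^sub>R z) * ennreal (r ^ (?n - 1)) \<partial>lborel) = (\<integral>\<^sup>+r\<in>I. ennreal (r powr (\<gamma> - 1)) \<partial>lborel)"
      by (rule nn_integral_cong) (rule eq)
    also have "\<dots> = ennreal (R powr \<gamma> / \<bar>\<gamma>\<bar>)"
    proof (cases "\<gamma> > 0")
      case True
      then show ?thesis using R(1) nn_integral_powr_from_0[of "\<gamma> - 1" R] by (simp add: I_def)
    next
      case False
      then show ?thesis using R(1) \<gamma> nn_integral_powr_at_least[of "\<gamma> - 1" R] by (simp add: I_def)
    qed
    finally show ?thesis by (simp add: R(3) flip: ennreal_mult)
  qed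
  have "(\<integral>\<^sup>+z. F z \<partial>lborel) = ennreal (real ?n) * (\<integral>\<^sup>+z\<in>ball 0 1.
    (\<integral>\<^sup>+r\<in>{0<..}. F ((r / norm z) *\<^sub>R z) * ennreal (r ^ (?n - 1)) \<partial>lborel) \<partial>lborel)"
    by (rule nn_integral_polar) simp
  also have "(\<integral>\<^sup>+z\<in>ball 0 1. (\<integral>\<^sup>+r\<in>{0<..}. F ((r / norm z) *\<^sub>R z) * ennreal (r ^ (?n - 1)) \<partial>lborel) \<partial>lborel)
    = (\<integral>\<^sup>+z. ennreal (1 / \<bar>\<gamma>\<bar>) * (ennreal ((h z / t) powr q) * indicator (ball 0 1) z) \<partial>lborel)"
    by (rule nn_integral_cong_AE, rule AE_mp[OF AE_lborel_singleton[of 0]])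
      (rule AE_I2, rule impI, subst inner, assumption, simp only: mult.assoc)
  also have "\<dots> = ennreal (1 / \<bar>\<gamma>\<bar>) * (\<integral>\<^sup>+z\<in>ball 0 1. ennreal ((h z / t) powr q) \<partial>lborel)"
    by (rule nn_integral_cmult) measurable
  also have "ennreal (real ?n) * \<dots> = ennreal (real ?n * (1 / \<bar>\<gamma>\<bar>)) * (\<integral>\<^sup>+z\<in>ball 0 1. ennreal ((h z / t) powr q) \<partial>lborel)"
    by (subst ennreal_mult) (auto simp: mult.assoc)
  finally show ?thesis by (simp add: F_def)
qed

text \<open>By rotation invariance only \<open>norm v\<close> matters: a reflection carries the
  direction of \<open>v\<close> to the unit vector that \<open>kappa\<close> picks by
  \<open>SOME\<close>, and the length of \<open>v\<close> factors out by homogeneity.\<close>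

lemma nn_integral_sphere_inner_powr:
  fixes v :: "'a::euclidean_space"
  assumes q: "q > 0"
  shows "ennreal (real DIM('a)) * (\<integral>\<^sup>+z\<in>ball 0 1. ennreal (\<bar>v \<bullet> (z /\<^sub>R norm z)\<bar> powr q) \<partial>lborel)
    = ennreal (kappa q TYPE('a) * norm v powr q)"
proof -
  define e where "e = (SOME e::'a. norm e = 1)"
  have e: "norm e = 1"
    unfolding e_def by (rule someI_ex) (use vector_choose_size[of 1] in auto)
  define G where "G z = ennreal (\<bar>e \<bullet> (z /\<^sub>R norm z)\<bar> powr q) * indicator (ball 0 1) z" for z
  have [measurable]: "ball (0::'a) 1 \<in> sets borel" by simp
  have [measurable]: "G \<in> borel_measurable borel"
    unfolding G_def by measurable
  have bound: "\<bar>e \<bullet> (z /\<^sub>R norm z)\<bar> powr q \<le> 1" for z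
  proof -
    have "\<bar>e \<bullet> (z /\<^sub>R norm z)\<bar> \<le> 1"
      using Cauchy_Schwarz_ineq2[of e "z /\<^sub>R norm z"] e by (cases "z = 0") auto
    then show ?thesis
      using q powr_mono2[of q "\<bar>e \<bullet> (z /\<^sub>R norm z)\<bar>" 1] by simp
  qed
  \<comment> \<open>\<open>kappa\<close> is a Bochner integral, which would default to 0 without
    integrability; boundedness of the integrand on the unit ball rules this out.\<close>
  have kap: "ennreal (kappa q TYPE('a)) = ennreal (real DIM('a)) * (\<integral>\<^sup>+z. G z \<partial>lborel)"
  proof -
    have "integrable lebesgue (\<lambda>z. indicator (ball 0 1) z *\<^sub>R (\<bar>e \<bullet> (z /\<^sub>R norm z)\<bar> powr q))"
    proof (rule Bochner_Integration.integrable_bound)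
      show "integrable lebesgue (indicator (ball (0::'a) 1) :: 'a \<Rightarrow> real)"
        using emeasure_lborel_ball_finite[of "0::'a" 1] by (simp add: integrable_indicator_iff)
      have "(\<lambda>z. indicator (ball 0 1) z *\<^sub>R (\<bar>e \<bullet> (z /\<^sub>R norm z)\<bar> powr q)) \<in> borel_measurable lborel"
        by measurable
      then show "(\<lambda>z. indicator (ball 0 1) z *\<^sub>R (\<bar>e \<bullet> (z /\<^sub>R norm z)\<bar> powr q)) \<in> meas_fun"
        by (rule measurable_completion)
    qed (use bound in \<open>auto simp: indicator_def\<close>)
    then have "(\<integral>\<^sup>+z. ennreal (indicator (ball 0 1) z *\<^sub>R (\<bar>e \<bullet> (z /\<^sub>R norm z)\<bar> powr q)) \<partial>lebesgue)
      = ennreal (LINT z : ball 0 1 | lebesgue. \<bar>e \<bullet> (z /\<^sub>R norm z)\<bar> powr q)"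
      unfolding set_lebesgue_integral_def by (rule nn_integral_eq_integral) (auto simp: indicator_def)
    also have "(\<integral>\<^sup>+z. ennreal (indicator (ball 0 1) z *\<^sub>R (\<bar>e \<bullet> (z /\<^sub>R norm z)\<bar> powr q)) \<partial>lebesgue) = (\<integral>\<^sup>+z. G z \<partial>lborel)"
      unfolding nn_integral_completion by (rule nn_integral_cong) (simp add: G_def indicator_def)
    finally have "ennreal (LINT z : ball 0 1 | lebesgue. \<bar>e \<bullet> (z /\<^sub>R norm z)\<bar> powr q) = (\<integral>\<^sup>+z. G z \<partial>lborel)"
      by (rule sym)
    then show ?thesis
      by (simp add: kappa_def sphere_integral_def ennreal_mult' flip: e_def)
  qed
  show ?thesis
  proof (cases "v = 0")
    case True
    then show ?thesis by simp
  next
    case False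
    define u where "u = v /\<^sub>R norm v"
    have u: "norm u = 1" "v = norm v *\<^sub>R u" using False by (auto simp: u_def)
    \<comment> \<open>T is the reflection exchanging e and u; it is the identity if e = u, since x / 0 = 0.\<close>
    define w where "w = e - u"
    define T where "T z = z - (2 * (z \<bullet> w) / (w \<bullet> w)) *\<^sub>R w" for z
    have ee: "e \<bullet> e = 1" "u \<bullet> u = 1" using e u by (simp_all add: dot_square_norm)
    \<comment> \<open>Both vectors have norm 1, so either side equals
      \<open>2 - 2 * (e \<bullet> u)\<close>. Hence the coefficient in \<open>T\<close> reduces to
      \<open>z \<bullet> w\<close> when paired with \<open>e\<close>, and \<open>e \<bullet> T z = e
      \<bullet> z - z \<bullet> w = u \<bullet> z\<close>.\<close>
    have ww: "w \<bullet> w = 2 * (e \<bullet> w)"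
      by (simp add: w_def inner_diff_left inner_diff_right ee inner_commute)
    have lin: "linear T"
      by (rule linearI) (simp_all add: T_def inner_add_left algebra_simps add_divide_distrib)
    have Tw: "T z \<bullet> w = - (z \<bullet> w)" for z
      by (cases "w = 0") (simp_all add: T_def inner_diff_left)
    have inv: "T (T z) = z" for z
      by (subst T_def) (simp only: Tw, simp add: T_def)
    have "T z \<bullet> T z = z \<bullet> z" for z
      by (cases "w = 0") (simp_all add: T_def inner_diff_left inner_diff_right inner_commute field_simps)
    then have iso: "norm (T z) = norm z" for z
      by (simp add: norm_eq)
    have adj: "e \<bullet> T z = u \<bullet> z" for z
    proof (cases "w = 0")
      case True
      then show ?thesis by (simp add: T_def w_def)
    next
      case False
      then have "e \<bullet> w \<noteq> 0" using ww by auto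
      then have "e \<bullet> T z = e \<bullet> z - z \<bullet> w"
        by (simp add: T_def inner_diff_right ww)
      then show ?thesis by (simp add: w_def inner_diff_right inner_commute)
    qed
    have "(\<integral>\<^sup>+z\<in>ball 0 1. ennreal (\<bar>v \<bullet> (z /\<^sub>R norm z)\<bar> powr q) \<partial>lborel)
      = (\<integral>\<^sup>+z. ennreal (norm v powr q) * G (T z) \<partial>lborel)"
    proof (rule nn_integral_cong)
      fix z :: 'a
      have "\<bar>v \<bullet> (z /\<^sub>R norm z)\<bar> = norm v * \<bar>e \<bullet> (T z /\<^sub>R norm (T z))\<bar>"
        by (subst u(2)) (simp add: adj iso abs_mult)
      then show "ennreal (\<bar>v \<bullet> (z /\<^sub>R norm z)\<bar> powr q) * indicator (ball 0 1) z = ennreal (norm v powr q) * G (T z)"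
        by (simp add: G_def iso indicator_def powr_mult ennreal_mult')
    qed
    also have "\<dots> = ennreal (norm v powr q) * (\<integral>\<^sup>+z. G (T z) \<partial>lborel)"
    proof (rule nn_integral_cmult)
      have "T \<in> borel_measurable borel"
        using lin by (intro borel_measurable_continuous_onI linear_continuous_on) (simp add: linear_conv_bounded_linear)
      then show "(\<lambda>z. G (T z)) \<in> borel_measurable lborel" by measurable
    qed
    also have "(\<integral>\<^sup>+z. G (T z) \<partial>lborel) = (\<integral>\<^sup>+z. G z \<partial>lborel)"
      by (rule nn_integral_linear_isometry[OF _ lin iso inv]) simp
    finally show ?thesis
      by (simp add: kap ennreal_mult'' ac_simps)
  qed
qed

lemma kappa_nonneg: "kappa q TYPE('a::euclidean_space) \<ge> 0"
  by (auto simp: kappa_def sphere_integral_def set_lebesgue_integral_def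
      intro!: mult_nonneg_nonneg integral_nonneg_AE)

subsection \<open>Functions with compactly supported gradient\<close>

text \<open>Let \<open>(1 + \<theta>) powr s = 1 + \<eta>\<close>. If
  \<open>b \<le> \<theta> * a\<close>, the sum is at most \<open>(1 + \<theta>) * a\<close>;
  otherwise \<open>a\<close> is dominated by \<open>b / \<theta>\<close> and the second term alone
  suffices. No case distinction at \<open>s = 1\<close> occurs, so the lemma serves both
  \<open>q\<close> and \<open>1 / q\<close>.\<close>

lemma powr_add_le:
  fixes s \<eta> :: real
  assumes s: "s > 0" and \<eta>: "\<eta> > 0"
  obtains C where "C \<ge> 0" "\<And>a b. 0 \<le> a \<Longrightarrow> 0 \<le> b \<Longrightarrow> (a + b) powr s \<le> (1 + \<eta>) * a powr s + C * b powr s"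
proof -
  define \<theta> where "\<theta> = (1 + \<eta>) powr (1 / s) - 1"
  have \<theta>: "\<theta> > 0" using s \<eta> powr_less_mono2[of "1 / s" 1 "1 + \<eta>"] by (simp add: \<theta>_def)
  have \<theta>s: "(1 + \<theta>) powr s = 1 + \<eta>" using s \<eta> by (simp add: \<theta>_def powr_powr)
  show thesis
  proof (rule that[of "(1 + 1 / \<theta>) powr s"])
    fix a b :: real assume ab: "0 \<le> a" "0 \<le> b"
    show "(a + b) powr s \<le> (1 + \<eta>) * a powr s + (1 + 1 / \<theta>) powr s * b powr s"
    proof (cases "b \<le> \<theta> * a")
      case True
      then have "(a + b) powr s \<le> ((1 + \<theta>) * a) powr s"
        using ab s by (intro powr_mono2) (auto simp: algebra_simps)
      also have "\<dots> = (1 + \<eta>) * a powr s" using ab \<theta> \<theta>s by (simp add: powr_mult)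
      finally show ?thesis by (simp add: add_increasing2)
    next
      case False
      then have "(a + b) powr s \<le> ((1 + 1 / \<theta>) * b) powr s"
        using ab s \<theta> by (intro powr_mono2) (auto simp: field_simps)
      also have "\<dots> = (1 + 1 / \<theta>) powr s * b powr s" using ab \<theta> by (simp add: powr_mult)
      finally show ?thesis using \<eta> by (simp add: add_increasing)
    qed
  qed simp
qed

text \<open>Only the gradient has bounded support, as in (i); \<open>f\<close> itself may be a
  nonzero constant near infinity.\<close>

locale compact_gradient =
  fixes f :: "'a::euclidean_space \<Rightarrow> real" and Df :: "'a \<Rightarrow> 'a" and R :: real
  assumes grad: "\<And>x. GDERIV f x :> Df x" and cont: "continuous_on UNIV Df"
    and supp: "\<And>x. R \<le> norm x \<Longrightarrow> Df x = 0" and R: "R > 0"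
begin

lemma f_deriv: "(f has_derivative (\<lambda>h. h \<bullet> Df x)) (at x within S)"
  using grad[of x] by (simp add: gderiv_def has_derivative_at_withinI)

lemma f_cont: "continuous_on UNIV f"
  using f_deriv by (meson continuous_on_eq_continuous_within has_derivative_continuous)

lemma f_borel [measurable]: "f \<in> borel_measurable borel"
  using f_cont by (rule borel_measurable_continuous_onI)

lemma Df_borel [measurable]: "Df \<in> borel_measurable borel"
  using cont by (rule borel_measurable_continuous_onI)

text \<open>Mean value inequality for \<open>f\<close> minus the linear function with gradient
  \<open>w\<close>. The choice \<open>w = 0\<close> gives the Lipschitz bound and local constancy,
  \<open>w = Df x\<close> the first-order expansion at \<open>x\<close>.\<close>

lemma f_diff_bound:
  assumes S: "convex S" "x \<in> S" "y \<in> S" and B: "\<And>z. z \<in> S \<Longrightarrow> norm (Df z - w) \<le> B"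
  shows "\<bar>f x - f y - (x - y) \<bullet> w\<bar> \<le> B * norm (x - y)"
proof -
  have "norm ((f x - x \<bullet> w) - (f y - y \<bullet> w)) \<le> B * norm (x - y)"
  proof (rule differentiable_bound[OF S(1) _ _ S(2,3)])
    fix z assume z: "z \<in> S"
    show "((\<lambda>x. f x - x \<bullet> w) has_derivative (\<lambda>h. h \<bullet> (Df z - w))) (at z within S)"
      by (auto intro!: derivative_eq_intros f_deriv simp: inner_diff_right)
    show "onorm (\<lambda>h. h \<bullet> (Df z - w)) \<le> B"
    proof (rule onorm_le)
      fix h :: 'a
      have "norm (h \<bullet> (Df z - w)) \<le> norm h * norm (Df z - w)" by (simp add: Cauchy_Schwarz_ineq2)
      also have "\<dots> \<le> norm h * B" using B[OF z] by (intro mult_left_mono) auto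
      finally show "norm (h \<bullet> (Df z - w)) \<le> B * norm h" by (simp add: mult.commute)
    qed
  qed
  then show ?thesis by (simp add: inner_diff_left algebra_simps)
qed

lemma Df_bounded: obtains L where "L > 0" "\<And>x. norm (Df x) \<le> L"
proof -
  have "bounded (Df ` cball 0 R)"
    by (intro compact_imp_bounded compact_continuous_image continuous_on_subset[OF cont]) auto
  then obtain L where L: "L > 0" "\<And>x. x \<in> cball 0 R \<Longrightarrow> norm (Df x) \<le> L"
    by (auto simp: bounded_pos)
  have "norm (Df x) \<le> L" for x using L supp[of x] by (cases "norm x \<le> R") auto
  then show thesis using L that by blast
qed

lemma f_Lipschitz: obtains L where "L > 0" "\<And>x y. \<bar>f x - f y\<bar> \<le> L * norm (x - y)"
proof -
  obtain L where L: "L > 0" "\<And>x. norm (Df x) \<le> L" using Df_bounded by blast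
  have "\<bar>f x - f y\<bar> \<le> L * norm (x - y)" for x y
    using f_diff_bound[of UNIV x y 0 L] L by simp
  then show thesis using L that by blast
qed

text \<open>The unit ball about \<open>x\<close> is convex and lies where the gradient vanishes.
  Constancy is only local: in dimension one the values at the two ends may differ. This is one
  reason for keeping \<open>\<delta> \<le> 1\<close> below.\<close>

lemma f_locally_constant:
  assumes "norm x \<ge> R + 1" "norm (x - y) < 1"
  shows "f x = f y"
proof -
  have "norm (Df z - 0) \<le> 0" if "z \<in> ball x 1" for z
  proof -
    have "norm x \<le> norm z + norm (x - z)" by norm
    then have "norm z \<ge> R" using that assms by (simp add: dist_norm)
    then show ?thesis using supp by simp
  qed
  then show ?thesis
    using f_diff_bound[of "ball x 1" x y 0 0] assms by (simp add: dist_norm)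
qed

text \<open>Compactness gives this on a ball of radius \<open>R + 1\<close> only. If one of two
  points less than 1 apart lies outside that ball, both have norm at least \<open>R\<close>, where
  the gradient is zero.\<close>

lemma Df_uniformly_continuous:
  assumes "\<epsilon> > 0"
  obtains \<delta> where "0 < \<delta>" "\<delta> \<le> 1" "\<And>x y. norm (x - y) < \<delta> \<Longrightarrow> norm (Df y - Df x) \<le> \<epsilon>"
proof -
  have "uniformly_continuous_on (cball 0 (R + 1)) Df"
    by (intro compact_uniformly_continuous continuous_on_subset[OF cont]) auto
  then obtain d where d: "d > 0" "\<And>x y. x \<in> cball 0 (R + 1) \<Longrightarrow> y \<in> cball 0 (R + 1) \<Longrightarrow> dist y x < d \<Longrightarrow> dist (Df y) (Df x) < \<epsilon>"
    using assms unfolding uniformly_continuous_on_def by metis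
  show thesis
  proof (rule that[of "min d 1"])
    fix x y :: 'a assume xy: "norm (x - y) < min d 1"
    show "norm (Df y - Df x) \<le> \<epsilon>"
    proof (cases "x \<in> cball 0 (R + 1) \<and> y \<in> cball 0 (R + 1)")
      case True
      then show ?thesis using d(2)[of x y] xy by (simp add: dist_norm norm_minus_commute)
    next
      case False
      have "norm x \<le> norm y + norm (x - y)" "norm y \<le> norm x + norm (x - y)" by norm+
      then have "norm x \<ge> R" "norm y \<ge> R" using False xy by auto
      then show ?thesis using supp assms by simp
    qed
  qed (use d in auto)
qed

lemma f_diff_le_directional:
  assumes "\<epsilon> > 0"
  obtains \<delta> where "0 < \<delta>" "\<delta> \<le> 1"
    "\<And>x y. norm (x - y) < \<delta> \<Longrightarrow> \<bar>f x - f y\<bar> \<le> (\<bar>Df x \<bullet> ((y - x) /\<^sub>R norm (y - x))\<bar> + \<epsilon>) * norm (x - y)"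
proof -
  obtain \<delta> where \<delta>: "0 < \<delta>" "\<delta> \<le> 1" "\<And>x y. norm (x - y) < \<delta> \<Longrightarrow> norm (Df y - Df x) \<le> \<epsilon>"
    using Df_uniformly_continuous[OF assms] by blast
  show thesis
  proof (rule that[OF \<delta>(1,2)])
    fix x y :: 'a assume xy: "norm (x - y) < \<delta>"
    have "\<bar>f x - f y - (x - y) \<bullet> Df x\<bar> \<le> \<epsilon> * norm (x - y)"
      using \<delta> xy by (intro f_diff_bound[of "ball x \<delta>"]) (auto simp: dist_norm)
    moreover have "\<bar>Df x \<bullet> ((y - x) /\<^sub>R norm (y - x))\<bar> * norm (x - y) = \<bar>(x - y) \<bullet> Df x\<bar>"
    proof (cases "x = y")
      case False
      then have "\<bar>Df x \<bullet> ((y - x) /\<^sub>R norm (y - x))\<bar> = \<bar>(x - y) \<bullet> Df x\<bar> / norm (x - y)"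
        by (simp add: abs_mult norm_minus_commute divide_inverse inner_commute inner_diff_right abs_minus_commute mult.commute)
      then show ?thesis using False by simp
    qed simp
    ultimately show "\<bar>f x - f y\<bar> \<le> (\<bar>Df x \<bullet> ((y - x) /\<^sub>R norm (y - x))\<bar> + \<epsilon>) * norm (x - y)"
      by (simp add: distrib_right)
  qed
qed

text \<open>The inner integral of \<open>Efun\<close>, restricted to \<open>A\<close> and left in
  \<open>ennreal\<close>: an infinite value would become 0 under \<open>enn2real\<close>, so
  splitting and estimating come before that conversion.\<close>

definition Eint :: "real \<Rightarrow> real \<Rightarrow> real \<Rightarrow> 'a set \<Rightarrow> 'a \<Rightarrow> ennreal" where
  "Eint t \<gamma> q A x = (\<integral>\<^sup>+y\<in>A. indicator (Eset t (\<gamma> / q) f) (x, y)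
      * ennreal (norm (x - y) powr (\<gamma> - real DIM('a))) \<partial>lborel)"

lemma Efun_eq: "Efun t \<gamma> q f x = enn2real (Eint t \<gamma> q UNIV x) powr (1 / q)"
  by (simp add: Efun_def Eint_def nn_integral_completion)

lemma Eset_borel [measurable]: "Measurable.pred (borel \<Otimes>\<^sub>M borel) (\<lambda>z. z \<in> Eset t \<beta> f)"
proof -
  have "(\<lambda>z. z \<in> Eset t \<beta> f) = (\<lambda>z. fst z \<noteq> snd z \<and> \<bar>f (fst z) - f (snd z)\<bar> / norm (fst z - snd z) powr (1 + \<beta>) > t)"
    by (auto simp: Eset_def)
  then show ?thesis by simp
qed

lemma Efun_meas [measurable]: "Efun t \<gamma> q f \<in> meas_fun"
proof -
  have "(\<lambda>x. Eint t \<gamma> q UNIV x) \<in> borel_measurable borel"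
  proof -
    have "(\<lambda>z. if z \<in> Eset t (\<gamma> / q) f then ennreal (norm (fst z - snd z) powr (\<gamma> - real DIM('a))) else 0)
      \<in> borel_measurable (borel \<Otimes>\<^sub>M lborel)" by measurable
    then have "(\<lambda>x. \<integral>\<^sup>+y. (if (x, y) \<in> Eset t (\<gamma> / q) f then ennreal (norm (x - y) powr (\<gamma> - real DIM('a))) else 0) \<partial>lborel)
      \<in> borel_measurable borel"
      by (intro lborel.borel_measurable_nn_integral) (simp add: case_prod_unfold)
    also have "(\<lambda>x. \<integral>\<^sup>+y. (if (x, y) \<in> Eset t (\<gamma> / q) f then ennreal (norm (x - y) powr (\<gamma> - real DIM('a))) else 0) \<partial>lborel)
      = (\<lambda>x. Eint t \<gamma> q UNIV x)"
      unfolding Eint_def by (intro ext nn_integral_cong) (simp add: indicator_def)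
    finally show ?thesis .
  qed
  then have "Efun t \<gamma> q f \<in> borel_measurable lborel"
    unfolding Efun_eq[abs_def] by measurable
  then show ?thesis by (rule measurable_completion)
qed

text \<open>The directional estimate puts the section into a homogeneous one with \<open>h z =
  \<bar>Df x \<bullet> (z /\<^sub>R norm z)\<bar> + \<epsilon>\<close>, whose weighted measure is
  known exactly; \<epsilon> also makes \<open>h\<close> positive. Splitting
  \<open>h z powr q\<close> separates the gradient term, which yields kappa, from the error.
  \<open>C\<close> is fixed before \<epsilon>, and \<delta> depends neither on x nor on t.\<close>

lemma Eint_ball_le:
  assumes q: "q > 0" and \<gamma>: "\<gamma> \<noteq> 0" and \<eta>: "\<eta> > 0"
  obtains C where "C \<ge> 0" "\<And>\<epsilon>. \<epsilon> > 0 \<Longrightarrow> \<exists>\<delta>. 0 < \<delta> \<and> \<delta> \<le> 1 \<and> (\<forall>x t. t > 0 \<longrightarrow>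
     Eint t \<gamma> q (ball x \<delta>) x \<le> ennreal (t powr - q * ((1 + \<eta>) * (kappa q TYPE('a) / \<bar>\<gamma>\<bar>) * norm (Df x) powr q + C * \<epsilon> powr q)))"
proof -
  let ?n = "DIM('a)"
  obtain C where C: "C \<ge> 0" "\<And>a b. 0 \<le> a \<Longrightarrow> 0 \<le> b \<Longrightarrow> (a + b) powr q \<le> (1 + \<eta>) * a powr q + C * b powr q"
    using powr_add_le[OF q \<eta>] by blast
  \<comment> \<open>The error term does not depend on the direction, so its integral over the unit
    ball produces the volume \<open>m\<close>; together with \<open>n / \<bar>\<gamma>\<bar>\<close>
    from the section formula this gives the constant chosen below.\<close>
  define m where "m = measure lborel (ball (0::'a) 1)"
  have m: "emeasure lborel (ball (0::'a) 1) = ennreal m" "m \<ge> 0"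
    unfolding m_def using emeasure_lborel_ball_finite[of "0::'a" 1] by (auto intro!: emeasure_eq_ennreal_measure)
  have [measurable]: "ball (0::'a) r \<in> sets borel" for r by simp
  show thesis
  proof (rule that[of "real ?n / \<bar>\<gamma>\<bar> * (C * m)"])
    show "real ?n / \<bar>\<gamma>\<bar> * (C * m) \<ge> 0" using C m by simp
    fix \<epsilon> :: real assume \<epsilon>: "\<epsilon> > 0"
    obtain \<delta> where \<delta>: "0 < \<delta>" "\<delta> \<le> 1"
      "\<And>x y. norm (x - y) < \<delta> \<Longrightarrow> \<bar>f x - f y\<bar> \<le> (\<bar>Df x \<bullet> ((y - x) /\<^sub>R norm (y - x))\<bar> + \<epsilon>) * norm (x - y)"
      using f_diff_le_directional[OF \<epsilon>] by blast
    have "Eint t \<gamma> q (ball x \<delta>) x \<le> ennreal (t powr - q * ((1 + \<eta>) * (kappa q TYPE('a) / \<bar>\<gamma>\<bar>) * norm (Df x) powr q + real ?n / \<bar>\<gamma>\<bar> * (C * m) * \<epsilon> powr q))"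
      if t: "t > 0" for x t
    proof -
      define h where "h z = \<bar>Df x \<bullet> (z /\<^sub>R norm z)\<bar> + \<epsilon>" for z
      have [measurable]: "h \<in> borel_measurable borel" unfolding h_def by measurable
      have h0: "h z > 0" for z using \<epsilon> by (simp add: h_def add_nonneg_pos)
      define G where "G z = ennreal (norm z powr (\<gamma> - real ?n)) * indicator {z. z \<noteq> 0 \<and> t * norm z powr (\<gamma> / q) < h z} z" for z :: 'a
      have [measurable]: "G \<in> borel_measurable borel" unfolding G_def by measurable
      have "Eint t \<gamma> q (ball x \<delta>) x \<le> (\<integral>\<^sup>+y. G (- x + y) \<partial>lborel)"
        unfolding Eint_def
      proof (rule nn_integral_mono)
        fix y
        show "indicator (Eset t (\<gamma> / q) f) (x, y) * ennreal (norm (x - y) powr (\<gamma> - real ?n)) * indicator (ball x \<delta>) y \<le> G (- x + y)"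
        proof (cases "(x, y) \<in> Eset t (\<gamma> / q) f \<and> y \<in> ball x \<delta>")
          case True
          then have xy: "x \<noteq> y" "norm (x - y) < \<delta>" "t < \<bar>f x - f y\<bar> / norm (x - y) powr (1 + \<gamma> / q)"
            by (auto simp: Eset_def dist_norm)
          then have r: "norm (x - y) > 0" by simp
          have "t * (norm (x - y) * norm (x - y) powr (\<gamma> / q)) < \<bar>f x - f y\<bar>"
            using xy(3) r by (simp add: field_simps powr_add)
          also have "\<dots> \<le> h (y - x) * norm (x - y)" using \<delta>(3)[OF xy(2)] by (simp add: h_def)
          finally have "t * norm (x - y) powr (\<gamma> / q) < h (y - x)"
            using r by (simp add: mult.left_commute mult.commute[of "h (y - x)"])
          then show ?thesis using xy(1) by (simp add: G_def norm_minus_commute indicator_def)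
        qed (auto simp: indicator_def)
      qed
      also have "\<dots> = (\<integral>\<^sup>+z. G z \<partial>lborel)"
        by (rule nn_integral_lborel_translate) simp
      also have "\<dots> = ennreal (real ?n / \<bar>\<gamma>\<bar>) * (\<integral>\<^sup>+z\<in>ball 0 1. ennreal ((h z / t) powr q) \<partial>lborel)"
        unfolding G_def
      proof (rule nn_integral_homogeneous_section)
        fix c :: real and z :: 'a assume "c > 0"
        then have "(c *\<^sub>R z) /\<^sub>R norm (c *\<^sub>R z) = z /\<^sub>R norm z" by (simp add: field_simps)
        then show "h (c *\<^sub>R z) = h z" by (simp only: h_def)
      qed (use h0 t q \<gamma> in auto)
      also have "\<dots> \<le> ennreal (real ?n / \<bar>\<gamma>\<bar>) * (\<integral>\<^sup>+z. ennreal (t powr - q * (1 + \<eta>)) * (ennreal (\<bar>Df x \<bullet> (z /\<^sub>R norm z)\<bar> powr q) * indicator (ball 0 1) z)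
           + ennreal (t powr - q * (C * \<epsilon> powr q)) * indicator (ball 0 1) z \<partial>lborel)"
      proof (intro mult_left_mono nn_integral_mono)
        fix z :: 'a
        have "(h z / t) powr q = t powr - q * h z powr q"
          using h0[of z] t by (simp add: powr_divide powr_minus field_simps)
        also have "\<dots> \<le> t powr - q * ((1 + \<eta>) * \<bar>Df x \<bullet> (z /\<^sub>R norm z)\<bar> powr q + C * \<epsilon> powr q)"
          unfolding h_def using \<epsilon> by (intro mult_left_mono C(2)) auto
        also have "\<dots> = t powr - q * (1 + \<eta>) * \<bar>Df x \<bullet> (z /\<^sub>R norm z)\<bar> powr q + t powr - q * (C * \<epsilon> powr q)"
          by (simp add: algebra_simps)
        finally have "ennreal ((h z / t) powr q) \<le> ennreal (t powr - q * (1 + \<eta>) * \<bar>Df x \<bullet> (z /\<^sub>R norm z)\<bar> powr q + t powr - q * (C * \<epsilon> powr q))"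
          by (rule ennreal_leI)
        also have "\<dots> = ennreal (t powr - q * (1 + \<eta>)) * ennreal (\<bar>Df x \<bullet> (z /\<^sub>R norm z)\<bar> powr q) + ennreal (t powr - q * (C * \<epsilon> powr q))"
          using C(1) \<eta> by (subst ennreal_plus) (auto simp: ennreal_mult)
        finally have "ennreal ((h z / t) powr q) \<le> ennreal (t powr - q * (1 + \<eta>)) * ennreal (\<bar>Df x \<bullet> (z /\<^sub>R norm z)\<bar> powr q) + ennreal (t powr - q * (C * \<epsilon> powr q))" .
        then show "ennreal ((h z / t) powr q) * indicator (ball 0 1) z \<le> ennreal (t powr - q * (1 + \<eta>)) * (ennreal (\<bar>Df x \<bullet> (z /\<^sub>R norm z)\<bar> powr q) * indicator (ball 0 1) z)
           + ennreal (t powr - q * (C * \<epsilon> powr q)) * indicator (ball 0 1) z"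
          by (cases "z \<in> ball 0 1") auto
      qed simp
      also have "\<dots> = ennreal (real ?n / \<bar>\<gamma>\<bar>) * (ennreal (t powr - q * (1 + \<eta>)) * (\<integral>\<^sup>+z\<in>ball 0 1. ennreal (\<bar>Df x \<bullet> (z /\<^sub>R norm z)\<bar> powr q) \<partial>lborel)
           + ennreal (t powr - q * (C * \<epsilon> powr q)) * ennreal m)"
        by (subst nn_integral_add, measurable, subst nn_integral_cmult, measurable, subst nn_integral_cmult_indicator) (auto simp: m)
      also have "\<dots> = ennreal (t powr - q * (1 + \<eta>) / \<bar>\<gamma>\<bar>) * (ennreal (real ?n) * (\<integral>\<^sup>+z\<in>ball 0 1. ennreal (\<bar>Df x \<bullet> (z /\<^sub>R norm z)\<bar> powr q) \<partial>lborel))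
           + ennreal (real ?n / \<bar>\<gamma>\<bar> * (t powr - q * (C * \<epsilon> powr q)) * m)"
      proof -
        have e1: "ennreal (real ?n / \<bar>\<gamma>\<bar>) * (ennreal (t powr - q * (1 + \<eta>)) * I) = ennreal (t powr - q * (1 + \<eta>) / \<bar>\<gamma>\<bar>) * (ennreal (real ?n) * I)" for I
        proof -
          have "ennreal (real ?n / \<bar>\<gamma>\<bar>) * ennreal (t powr - q * (1 + \<eta>)) = ennreal (t powr - q * (1 + \<eta>) / \<bar>\<gamma>\<bar>) * ennreal (real ?n)"
            using \<eta> by (subst (1 2) ennreal_mult[symmetric]) (auto simp: mult.commute)
          then show ?thesis by (metis mult.assoc)
        qed
        have e2: "ennreal (real ?n / \<bar>\<gamma>\<bar>) * (ennreal (t powr - q * (C * \<epsilon> powr q)) * ennreal m) = ennreal (real ?n / \<bar>\<gamma>\<bar> * (t powr - q * (C * \<epsilon> powr q)) * m)"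
          using C(1) m(2) by (simp add: mult.assoc flip: ennreal_mult)
        show ?thesis unfolding e1[symmetric] e2[symmetric] by (rule distrib_left)
      qed
      also have "\<dots> = ennreal (t powr - q * (1 + \<eta>) / \<bar>\<gamma>\<bar> * (kappa q TYPE('a) * norm (Df x) powr q) + real ?n / \<bar>\<gamma>\<bar> * (t powr - q * (C * \<epsilon> powr q)) * m)"
        unfolding nn_integral_sphere_inner_powr[OF q] using kappa_nonneg[of q, where 'a='a] C(1) m(2) \<eta>
        by (subst ennreal_mult[symmetric], simp, simp, subst ennreal_plus[symmetric]) auto
      also have "t powr - q * (1 + \<eta>) / \<bar>\<gamma>\<bar> * (kappa q TYPE('a) * norm (Df x) powr q) + real ?n / \<bar>\<gamma>\<bar> * (t powr - q * (C * \<epsilon> powr q)) * m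
         = t powr - q * ((1 + \<eta>) * (kappa q TYPE('a) / \<bar>\<gamma>\<bar>) * norm (Df x) powr q + real ?n / \<bar>\<gamma>\<bar> * (C * m) * \<epsilon> powr q)"
        by (simp add: algebra_simps)
      finally show ?thesis .
    qed
    then show "\<exists>\<delta>. 0 < \<delta> \<and> \<delta> \<le> 1 \<and> (\<forall>x t. t > 0 \<longrightarrow>
     Eint t \<gamma> q (ball x \<delta>) x \<le> ennreal (t powr - q * ((1 + \<eta>) * (kappa q TYPE('a) / \<bar>\<gamma>\<bar>) * norm (Df x) powr q + real ?n / \<bar>\<gamma>\<bar> * (C * m) * \<epsilon> powr q)))"
      using \<delta> by blast
  qed
qed

end

subsection \<open>The limits\<close>

text \<open>The order of the quantifiers matters: \<eta> is fixed first, with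
  \<open>\<eta> * A \<le> e / 2\<close>; this determines \<open>C\<close>, and only then is
  \<epsilon> chosen with \<open>C * \<epsilon> \<le> e / 2\<close>.\<close>

lemma Limsup_le_of_approx:
  fixes G :: "'b \<Rightarrow> ennreal"
  assumes A: "A \<ge> 0"
    and *: "\<And>\<eta>. \<eta> > 0 \<Longrightarrow> \<exists>C\<ge>0. \<forall>\<epsilon>>0. \<forall>\<^sub>F t in F. G t \<le> ennreal ((1 + \<eta>) * A + C * \<epsilon>)"
  shows "Limsup F G \<le> ennreal A"
proof (rule ennreal_le_epsilon)
  fix e :: real assume e: "e > 0"
  define \<eta> where "\<eta> = e / (2 * (A + 1))"
  have \<eta>: "\<eta> > 0" "\<eta> * A \<le> e / 2" using A e by (auto simp: \<eta>_def field_simps)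
  obtain C where C: "C \<ge> 0" "\<And>\<epsilon>. \<epsilon> > 0 \<Longrightarrow> \<forall>\<^sub>F t in F. G t \<le> ennreal ((1 + \<eta>) * A + C * \<epsilon>)"
    using *[OF \<eta>(1)] by blast
  define \<epsilon> where "\<epsilon> = e / (2 * (C + 1))"
  have \<epsilon>: "\<epsilon> > 0" "C * \<epsilon> \<le> e / 2" using C(1) e by (auto simp: \<epsilon>_def field_simps)
  have "(1 + \<eta>) * A + C * \<epsilon> \<le> A + e"
    using \<eta> \<epsilon> by (simp add: distrib_right)
  then have "\<forall>\<^sub>F t in F. G t \<le> ennreal (A + e)"
    using C(2)[OF \<epsilon>(1)] by (auto elim!: eventually_mono intro: order_trans ennreal_leI)
  then have "Limsup F G \<le> ennreal (A + e)"
    by (rule Limsup_bounded)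
  then show "Limsup F G \<le> ennreal A + ennreal e"
    using A e by simp
qed

locale BFS_gradient = ball_BFS_space N + compact_gradient f Df R
  for N :: "('a::euclidean_space \<Rightarrow> real) \<Rightarrow> ennreal"
    and f :: "'a \<Rightarrow> real" and Df :: "'a \<Rightarrow> 'a" and R :: real
begin

text \<open>The common core of both limits. \<open>W\<close> bounds the part of the section outside
  the small ball and is absorbed into the error once
  \<open>t powr q * W \<le> \<epsilon> powr q\<close>: for \<gamma> > 0 one takes
  \<open>W = 0\<close>, for \<gamma> < 0 a fixed tail integral and small t. The root
  \<open>1 / q\<close> turns \<open>t powr - q\<close> into \<open>1 / t\<close>, which the factor t
  cancels.\<close>

lemma Efun_estimate:
  assumes q: "q > 0" and \<gamma>: "\<gamma> \<noteq> 0" and \<eta>: "\<eta> > 0"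
  obtains C where "C \<ge> 0" "\<And>\<epsilon>. \<epsilon> > 0 \<Longrightarrow> \<exists>\<delta>. 0 < \<delta> \<and> \<delta> \<le> 1 \<and> (\<forall>x t W. t > 0 \<longrightarrow> 0 \<le> W \<longrightarrow> t powr q * W \<le> \<epsilon> powr q \<longrightarrow>
     Eint t \<gamma> q UNIV x \<le> Eint t \<gamma> q (ball x \<delta>) x + ennreal W \<longrightarrow>
     t * Efun t \<gamma> q f x \<le> (1 + \<eta>) * ((kappa q TYPE('a) / \<bar>\<gamma>\<bar>) powr (1 / q)) * norm (Df x) + C * \<epsilon>)"
proof -
  define k where "k = kappa q TYPE('a) / \<bar>\<gamma>\<bar>"
  have k: "k \<ge> 0" by (simp add: k_def kappa_nonneg)
  \<comment> \<open>The loss \<open>1 + \<eta>0\<close> occurs twice: under the root, from splitting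
    the power \<open>q\<close>, and outside it, from splitting the power \<open>1 / q\<close>. Hence
    \<open>(1 + \<eta>0) powr (1 + 1 / q)\<close> has to equal \<open>1 + \<eta>\<close>.\<close>
  define \<eta>0 where "\<eta>0 = (1 + \<eta>) powr (1 / (1 + 1 / q)) - 1"
  have q1: "1 + 1 / q > 0" using q by (simp add: add_pos_pos)
  have \<eta>0: "\<eta>0 > 0"
    using q1 \<eta> powr_less_mono2[of "1 / (1 + 1 / q)" 1 "1 + \<eta>"] by (simp add: \<eta>0_def)
  have "(1 + \<eta>0) * (1 + \<eta>0) powr (1 / q) = (1 + \<eta>0) powr (1 + 1 / q)"
    using \<eta>0 by (subst powr_add) simp
  also have "\<dots> = 1 + \<eta>"
    using \<eta> q1 by (simp add: \<eta>0_def powr_powr)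
  finally have \<eta>1: "(1 + \<eta>0) * (1 + \<eta>0) powr (1 / q) = 1 + \<eta>" .
  obtain C1 where C1: "C1 \<ge> 0" "\<And>\<epsilon>. \<epsilon> > 0 \<Longrightarrow> \<exists>\<delta>. 0 < \<delta> \<and> \<delta> \<le> 1 \<and> (\<forall>x t. t > 0 \<longrightarrow>
     Eint t \<gamma> q (ball x \<delta>) x \<le> ennreal (t powr - q * ((1 + \<eta>0) * k * norm (Df x) powr q + C1 * \<epsilon> powr q)))"
    unfolding k_def using Eint_ball_le[OF q \<gamma> \<eta>0] by blast
  have "1 / q > 0" using q by simp
  then obtain C2 where C2: "C2 \<ge> 0" "\<And>a b. 0 \<le> a \<Longrightarrow> 0 \<le> b \<Longrightarrow> (a + b) powr (1 / q) \<le> (1 + \<eta>0) * a powr (1 / q) + C2 * b powr (1 / q)"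
    using powr_add_le[OF _ \<eta>0] by blast
  show thesis
  proof (rule that[of "C2 * (C1 + 1) powr (1 / q)"])
    show "C2 * (C1 + 1) powr (1 / q) \<ge> 0" using C2 by simp
    fix \<epsilon> :: real assume \<epsilon>: "\<epsilon> > 0"
    obtain \<delta> where \<delta>: "0 < \<delta>" "\<delta> \<le> 1" "\<And>x t. t > 0 \<Longrightarrow>
     Eint t \<gamma> q (ball x \<delta>) x \<le> ennreal (t powr - q * ((1 + \<eta>0) * k * norm (Df x) powr q + C1 * \<epsilon> powr q))"
      using C1(2)[OF \<epsilon>] by blast
    have "t * Efun t \<gamma> q f x \<le> (1 + \<eta>) * k powr (1 / q) * norm (Df x) + C2 * (C1 + 1) powr (1 / q) * \<epsilon>"
      if t: "t > 0" and W: "0 \<le> W" "t powr q * W \<le> \<epsilon> powr q"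
        and E: "Eint t \<gamma> q UNIV x \<le> Eint t \<gamma> q (ball x \<delta>) x + ennreal W" for x t W
    proof -
      define a where "a = (1 + \<eta>0) * k * norm (Df x) powr q"
      \<comment> \<open>\<open>C1\<close> comes from the small ball, the additional 1 from
        \<open>W\<close>.\<close>
      define b where "b = (C1 + 1) * \<epsilon> powr q"
      have ab: "a \<ge> 0" "b \<ge> 0" using \<eta>0 k C1 by (auto simp: a_def b_def)
      have tq: "t powr - q * t powr q = 1" using t by (simp flip: powr_add)
      have "W = t powr - q * (t powr q * W)" using tq by (simp flip: mult.assoc)
      also have "\<dots> \<le> t powr - q * \<epsilon> powr q" using W(2) by (rule mult_left_mono) simp
      finally have W': "W \<le> t powr - q * \<epsilon> powr q" .
      have "Eint t \<gamma> q UNIV x \<le> ennreal (t powr - q * (a + C1 * \<epsilon> powr q)) + ennreal W"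
        using E \<delta>(3)[OF t, of x] unfolding a_def by (meson add_right_mono order_trans)
      also have "\<dots> = ennreal (t powr - q * (a + C1 * \<epsilon> powr q) + W)"
        using W ab C1 by simp
      also have "\<dots> \<le> ennreal (t powr - q * (a + b))"
        using W' by (intro ennreal_leI) (simp add: b_def algebra_simps)
      finally have "enn2real (Eint t \<gamma> q UNIV x) \<le> t powr - q * (a + b)"
        using ab by (intro enn2real_leI) auto
      then have "Efun t \<gamma> q f x \<le> (t powr - q * (a + b)) powr (1 / q)"
        unfolding Efun_eq using q by (intro powr_mono2) auto
      also have "\<dots> = (a + b) powr (1 / q) / t"
      proof -
        have "(t powr - q) powr (1 / q) = inverse t"
          unfolding powr_powr using q t by (simp add: powr_minus)
        then show ?thesis using ab by (simp add: powr_mult divide_inverse mult.commute)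
      qed
      finally have "t * Efun t \<gamma> q f x \<le> (a + b) powr (1 / q)"
        using t by (simp add: field_simps)
      also have "\<dots> \<le> (1 + \<eta>0) * a powr (1 / q) + C2 * b powr (1 / q)"
        by (rule C2(2)[OF ab])
      also have "a powr (1 / q) = (1 + \<eta>0) powr (1 / q) * k powr (1 / q) * norm (Df x)"
        using \<eta>0 k q by (simp add: a_def powr_mult powr_powr)
      also have "(1 + \<eta>0) * ((1 + \<eta>0) powr (1 / q) * k powr (1 / q) * norm (Df x)) = (1 + \<eta>) * k powr (1 / q) * norm (Df x)"
        by (simp flip: \<eta>1)
      also have "b powr (1 / q) = (C1 + 1) powr (1 / q) * \<epsilon>"
        using C1(1) \<epsilon> q by (simp add: b_def powr_mult powr_powr)
      finally show ?thesis by (simp add: mult.assoc)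
    qed
    then show "\<exists>\<delta>. 0 < \<delta> \<and> \<delta> \<le> 1 \<and> (\<forall>x t W. t > 0 \<longrightarrow> 0 \<le> W \<longrightarrow> t powr q * W \<le> \<epsilon> powr q \<longrightarrow>
     Eint t \<gamma> q UNIV x \<le> Eint t \<gamma> q (ball x \<delta>) x + ennreal W \<longrightarrow>
     t * Efun t \<gamma> q f x \<le> (1 + \<eta>) * ((kappa q TYPE('a) / \<bar>\<gamma>\<bar>) powr (1 / q)) * norm (Df x) + C2 * (C1 + 1) powr (1 / q) * \<epsilon>)"
      using \<delta> unfolding k_def by blast
  qed
qed

lemma Df_meas [measurable]: "Df \<in> borel_measurable lebesgue"
  by (rule measurable_completion) simp

lemma N_Df_real: obtains \<nu> where "\<nu> \<ge> 0" "N (\<lambda>x. norm (Df x)) = ennreal \<nu>"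
proof -
  obtain L where L: "L > 0" "\<And>x. norm (Df x) \<le> L" using Df_bounded by blast
  have "N (\<lambda>x. norm (Df x)) \<le> N (\<lambda>x. L * indicator (ball 0 R) x)"
  proof (rule N_mono)
    show "norm (Df x) \<le> L * indicator (ball 0 R) x" for x
      using L(2)[of x] supp[of x] by (cases "norm x < R") auto
  qed (auto simp: ball_meas)
  also have "\<dots> = ennreal L * N (indicator (ball 0 R))" using L by (simp add: N_scale ball_meas)
  also have "\<dots> < top" using N_ball_finite[of 0 R] by (simp add: ennreal_mult_less_top)
  finally show thesis using that by (cases "N (\<lambda>x. norm (Df x))") auto
qed

text \<open>Passes from a pointwise bound to norms. The triangle inequality with constant 1
  preserves the factor of the gradient; the other two terms will be small.\<close>

lemma N_combination:
  assumes le: "\<And>x. t * Efun t \<gamma> q f x \<le> a * norm (Df x) + b * indicator (ball 0 \<rho>) x + d * w x"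
    and w: "w \<in> meas_fun" "\<And>x. 0 \<le> w x" and nn: "t \<ge> 0" "a \<ge> 0" "b \<ge> 0" "d \<ge> 0"
  shows "ennreal t * N (Efun t \<gamma> q f) \<le> ennreal a * N (\<lambda>x. norm (Df x)) + ennreal b * N (indicator (ball 0 \<rho>)) + ennreal d * N w"
proof -
  have [measurable]: "w \<in> meas_fun" by fact
  have "ennreal t * N (Efun t \<gamma> q f) = N (\<lambda>x. t * Efun t \<gamma> q f x)"
    using nn by (simp add: N_scale)
  also have "\<dots> \<le> N (\<lambda>x. a * norm (Df x) + b * indicator (ball 0 \<rho>) x + d * w x)"
  proof (rule N_mono)
    show "0 \<le> t * Efun t \<gamma> q f x" for x using nn by (simp add: Efun_eq)
  qed (use le in \<open>auto intro!: borel_measurable_add borel_measurable_times simp: ball_meas\<close>)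
  also have "\<dots> \<le> N (\<lambda>x. a * norm (Df x)) + N (\<lambda>x. b * indicator (ball 0 \<rho>) x) + N (\<lambda>x. d * w x)"
    by (rule order_trans[OF N_triangle add_right_mono[OF N_triangle]]) measurable
  also have "\<dots> = ennreal a * N (\<lambda>x. norm (Df x)) + ennreal b * N (indicator (ball 0 \<rho>)) + ennreal d * N w"
    using nn w by (simp add: N_scale ball_meas)
  finally show ?thesis .
qed

lemma N_ball_real: obtains \<beta> where "\<beta> \<ge> 0" "N (indicator (ball c \<rho>)) = ennreal \<beta>"
  using N_ball_finite[of c \<rho>] by (cases "N (indicator (ball c \<rho>))") auto

lemma Eint_mono_set: "(\<And>y. (x, y) \<in> Eset t (\<gamma> / q) f \<Longrightarrow> y \<in> A \<Longrightarrow> y \<in> B) \<Longrightarrow> Eint t \<gamma> q A x \<le> Eint t \<gamma> q B x"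
  unfolding Eint_def by (intro nn_integral_mono) (auto simp: indicator_def)

lemma Limsup_Efun_at_top:
  assumes \<gamma>: "\<gamma> > 0" and q: "q > 0"
  shows "Limsup at_top (\<lambda>t. ennreal t * N (Efun t \<gamma> q f))
    \<le> ennreal ((kappa q TYPE('a) / \<gamma>) powr (1 / q)) * N (\<lambda>x. norm (Df x))"
proof -
  define c where "c = (kappa q TYPE('a) / \<bar>\<gamma>\<bar>) powr (1 / q)"
  have c: "c \<ge> 0" by (simp add: c_def)
  obtain \<nu> where \<nu>: "\<nu> \<ge> 0" "N (\<lambda>x. norm (Df x)) = ennreal \<nu>" using N_Df_real by blast
  obtain \<beta> where \<beta>: "\<beta> \<ge> 0" "N (indicator (ball 0 (R + 1))) = ennreal \<beta>" using N_ball_real by blast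
  obtain L where L: "L > 0" "\<And>x y. \<bar>f x - f y\<bar> \<le> L * norm (x - y)" using f_Lipschitz by blast
  have "Limsup at_top (\<lambda>t. ennreal t * N (Efun t \<gamma> q f)) \<le> ennreal (c * \<nu>)"
  proof (rule Limsup_le_of_approx)
    show "c * \<nu> \<ge> 0" using c \<nu> by simp
    fix \<eta> :: real assume \<eta>: "\<eta> > 0"
    obtain C where C: "C \<ge> 0" "\<And>\<epsilon>. \<epsilon> > 0 \<Longrightarrow> \<exists>\<delta>. 0 < \<delta> \<and> \<delta> \<le> 1 \<and> (\<forall>x t W. t > 0 \<longrightarrow> 0 \<le> W \<longrightarrow> t powr q * W \<le> \<epsilon> powr q \<longrightarrow>
     Eint t \<gamma> q UNIV x \<le> Eint t \<gamma> q (ball x \<delta>) x + ennreal W \<longrightarrow>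
     t * Efun t \<gamma> q f x \<le> (1 + \<eta>) * c * norm (Df x) + C * \<epsilon>)"
      unfolding c_def using Efun_estimate[OF q _ \<eta>, of \<gamma>] \<gamma> by (metis less_irrefl)
    have "\<forall>\<^sub>F t in at_top. ennreal t * N (Efun t \<gamma> q f) \<le> ennreal ((1 + \<eta>) * (c * \<nu>) + (C * \<beta>) * \<epsilon>)" if \<epsilon>: "\<epsilon> > 0" for \<epsilon>
    proof -
      obtain \<delta> where \<delta>: "0 < \<delta>" "\<delta> \<le> 1" "\<And>x t W. t > 0 \<Longrightarrow> 0 \<le> W \<Longrightarrow> t powr q * W \<le> \<epsilon> powr q \<Longrightarrow>
       Eint t \<gamma> q UNIV x \<le> Eint t \<gamma> q (ball x \<delta>) x + ennreal W \<Longrightarrow>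
       t * Efun t \<gamma> q f x \<le> (1 + \<eta>) * c * norm (Df x) + C * \<epsilon>"
        using C(2)[OF \<epsilon>] by blast
      show ?thesis
        using eventually_ge_at_top[of "max 1 (L / \<delta> powr (\<gamma> / q))"]
      proof eventually_elim
        case (elim t)
        then have t: "t > 0" "L \<le> t * \<delta> powr (\<gamma> / q)" using \<delta>(1) by (auto simp: field_simps)
        \<comment> \<open>By the Lipschitz bound, a pair in the set satisfies
          \<open>t * norm (x - y) powr (\<gamma> / q) < L\<close>; the threshold for t is the value
          at which this excludes \<open>norm (x - y) \<ge> \<delta>\<close>.\<close>
        have near: "norm (x - y) < \<delta>" if "(x, y) \<in> Eset t (\<gamma> / q) f" for x y
        proof (rule ccontr)
          assume "\<not> ?thesis"
          then have r: "norm (x - y) > 0" "\<delta> \<le> norm (x - y)" using \<delta> by auto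
          have "t < \<bar>f x - f y\<bar> / norm (x - y) powr (1 + \<gamma> / q)" using that by (simp add: Eset_def)
          then have "t * (norm (x - y) * norm (x - y) powr (\<gamma> / q)) < \<bar>f x - f y\<bar>"
            using r(1) by (simp add: field_simps powr_add)
          also have "\<dots> \<le> L * norm (x - y)" by (rule L)
          finally have "t * norm (x - y) powr (\<gamma> / q) < L"
            using r(1) by (simp add: mult.left_commute mult.commute[of L])
          moreover have "t * \<delta> powr (\<gamma> / q) \<le> t * norm (x - y) powr (\<gamma> / q)"
            using t(1) r \<delta>(1) \<gamma> q by (intro mult_left_mono powr_mono2) auto
          ultimately show False using t by linarith
        qed
        \<comment> \<open>The error \<open>C * \<epsilon>\<close> is needed only for
          \<open>norm x < R + 1\<close>: beyond, all relevant y have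
          \<open>norm (x - y) < \<delta> \<le> 1\<close>, where \<open>f\<close> equals
          \<open>f x\<close>, so the section is empty. The third term of
          \<open>N_combination\<close> is void here.\<close>
        have pt: "t * Efun t \<gamma> q f x \<le> ((1 + \<eta>) * c) * norm (Df x) + (C * \<epsilon>) * indicator (ball 0 (R + 1)) x + 0 * 0" for x
        proof (cases "norm x < R + 1")
          case True
          have "Eint t \<gamma> q UNIV x \<le> Eint t \<gamma> q (ball x \<delta>) x"
            using near by (intro Eint_mono_set) (auto simp: dist_norm)
          then show ?thesis using \<delta>(3)[OF t(1), of 0 x] \<epsilon> True by simp
        next
          case False
          have "Eint t \<gamma> q UNIV x \<le> Eint t \<gamma> q {} x"
          proof (rule Eint_mono_set)
            fix y assume *: "(x, y) \<in> Eset t (\<gamma> / q) f"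
            then have "f x = f y" using near[OF *] \<delta>(2) False by (intro f_locally_constant) auto
            then show "y \<in> {}" using * t by (simp add: Eset_def)
          qed
          then have "Efun t \<gamma> q f x = 0" by (simp add: Efun_eq Eint_def)
          then show ?thesis using \<eta> c C(1) \<epsilon> by simp
        qed
        have "ennreal t * N (Efun t \<gamma> q f) \<le> ennreal ((1 + \<eta>) * c) * ennreal \<nu> + ennreal (C * \<epsilon>) * ennreal \<beta> + ennreal 0 * N (\<lambda>x. 0)"
          unfolding \<nu>(2)[symmetric] \<beta>(2)[symmetric]
          by (rule N_combination[OF pt]) (use t \<eta> c C \<epsilon> in auto)
        also have "\<dots> = ennreal ((1 + \<eta>) * (c * \<nu>) + (C * \<beta>) * \<epsilon>)"
          using \<eta> c C(1) \<epsilon> \<nu>(1) \<beta>(1) by (simp add: ac_simps flip: ennreal_mult ennreal_plus)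
        finally show ?case .
      qed
    qed
    then show "\<exists>C\<ge>0. \<forall>\<epsilon>>0. \<forall>\<^sub>F t in at_top. ennreal t * N (Efun t \<gamma> q f) \<le> ennreal ((1 + \<eta>) * (c * \<nu>) + C * \<epsilon>)"
      using C(1) \<beta>(1) by (intro exI[of _ "C * \<beta>"]) auto
  qed
  then show ?thesis using c \<nu> \<gamma> by (simp add: c_def ennreal_mult)
qed

end

text \<open>The section formula with \<open>h = 1\<close> and \<open>q = 1\<close>: the choice of
  \<open>t\<close> makes the section the set \<open>norm z > \<delta> / 2\<close>. Halving \<delta>
  accommodates the strict inequality, as the complement of the open ball contains the sphere of
  radius \<delta>.\<close>

lemma nn_integral_power_tail_finite:
  assumes \<gamma>: "\<gamma> < 0" and \<delta>: "\<delta> > 0"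
  shows "(\<integral>\<^sup>+z\<in>- ball (0::'a::euclidean_space) \<delta>. ennreal (norm z powr (\<gamma> - real DIM('a))) \<partial>lborel) < top"
proof -
  let ?t = "(\<delta> / 2) powr - \<gamma>"
  have t: "?t > 0" using \<delta> by simp
  have "(\<integral>\<^sup>+z\<in>- ball (0::'a) \<delta>. ennreal (norm z powr (\<gamma> - real DIM('a))) \<partial>lborel)
    \<le> (\<integral>\<^sup>+z\<in>{z. z \<noteq> 0 \<and> ?t * norm z powr (\<gamma> / 1) < 1}. ennreal (norm z powr (\<gamma> - real DIM('a))) \<partial>(lborel::'a measure))"
  proof (rule nn_integral_mono)
    fix z :: 'a
    have "?t * norm z powr \<gamma> < 1" if "norm z \<ge> \<delta>"
    proof -
      have "norm z powr \<gamma> < (\<delta> / 2) powr \<gamma>"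
        using that \<delta> \<gamma> by (intro powr_less_mono2_neg) auto
      then have "?t * norm z powr \<gamma> < ?t * (\<delta> / 2) powr \<gamma>" using t by (rule mult_strict_left_mono)
      also have "\<dots> = 1" using \<delta> by (simp flip: powr_add)
      finally show ?thesis .
    qed
    then show "ennreal (norm z powr (\<gamma> - real DIM('a))) * indicator (- ball 0 \<delta>) z
      \<le> ennreal (norm z powr (\<gamma> - real DIM('a))) * indicator {z. z \<noteq> 0 \<and> ?t * norm z powr (\<gamma> / 1) < 1} z"
      using \<delta> by (auto simp: indicator_def)
  qed
  also have "\<dots> = ennreal (real DIM('a) / \<bar>\<gamma>\<bar>) * (\<integral>\<^sup>+z\<in>ball (0::'a) 1. ennreal ((1 / ?t) powr 1) \<partial>lborel)"
    by (rule nn_integral_homogeneous_section) (use t \<gamma> in auto)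
  also have "\<dots> = ennreal (real DIM('a) / \<bar>\<gamma>\<bar>) * (ennreal ((1 / ?t) powr 1) * emeasure lborel (ball (0::'a) 1))"
    by (subst nn_integral_cmult_indicator) auto
  also have "\<dots> < top"
    using emeasure_lborel_ball_finite[of "0::'a" 1] by (simp add: ennreal_mult_less_top)
  finally show ?thesis .
qed

context BFS_gradient
begin

lemma Limsup_Efun_at_right_0:
  assumes \<gamma>: "\<gamma> < 0" and q: "q > 0"
    and f0: "\<And>x. R \<le> norm x \<Longrightarrow> f x = 0" and R1: "R \<ge> 1"
    and decay: "N (\<lambda>x. norm x powr - ((real DIM('a) - \<gamma>) / q) * indicator (- ball 0 1) x) < \<infinity>"
  shows "Limsup (at_right 0) (\<lambda>t. ennreal t * N (Efun t \<gamma> q f))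
    \<le> ennreal ((- kappa q TYPE('a) / \<gamma>) powr (1 / q)) * N (\<lambda>x. norm (Df x))"
proof -
  let ?n = "DIM('a)"
  define s where "s = (real ?n - \<gamma>) / q"
  define w where "w x = norm x powr - s * indicator (- ball 0 1) x" for x :: 'a
  have [measurable]: "ball (0::'a) r \<in> sets borel" for r by simp
  have w: "w \<in> meas_fun" "\<And>x. 0 \<le> w x"
    unfolding w_def by (rule measurable_completion; measurable) simp
  obtain \<omega> where \<omega>: "\<omega> \<ge> 0" "N w = ennreal \<omega>"
    using decay by (cases "N w") (auto simp: w_def[abs_def] s_def)
  define c where "c = (kappa q TYPE('a) / \<bar>\<gamma>\<bar>) powr (1 / q)"
  have c: "c \<ge> 0" by (simp add: c_def)
  obtain \<nu> where \<nu>: "\<nu> \<ge> 0" "N (\<lambda>x. norm (Df x)) = ennreal \<nu>" using N_Df_real by blast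
  obtain \<beta> where \<beta>: "\<beta> \<ge> 0" "N (indicator (ball 0 (2 * R))) = ennreal \<beta>" using N_ball_real by blast
  define m where "m = measure lborel (ball (0::'a) R)"
  have m: "emeasure lborel (ball (0::'a) R) = ennreal m" "m \<ge> 0"
    unfolding m_def using emeasure_lborel_ball_finite[of "0::'a" R] by (auto intro!: emeasure_eq_ennreal_measure)
  \<comment> \<open>\<open>m\<close> is the volume of a ball containing the support, and the power
    of 2 comes from \<open>norm (x - y) \<ge> norm x / 2\<close>.\<close>
  define K where "K = (m * 2 powr (real ?n - \<gamma>)) powr (1 / q)"
  have K: "K \<ge> 0" by (simp add: K_def)
  \<comment> \<open>Here \<open>f x = 0\<close>, so only y with \<open>f y \<noteq> 0\<close>, hence
    \<open>norm y < R\<close>, contribute; the bound does not depend on t. Since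
    \<open>R \<ge> 1\<close>, such x lie outside the unit ball, where \<open>w\<close> is the pure
    power.\<close>
  have far: "Efun t \<gamma> q f x \<le> K * w x" if x: "2 * R \<le> norm x" and t: "t > 0" for t x
  proof -
    have x0: "norm x > 0" using x R1 by linarith
    have "Eint t \<gamma> q UNIV x \<le> (\<integral>\<^sup>+y. ennreal ((norm x / 2) powr (\<gamma> - real ?n)) * indicator (ball (0::'a) R) y \<partial>lborel)"
      unfolding Eint_def
    proof (rule nn_integral_mono)
      fix y
      show "indicator (Eset t (\<gamma> / q) f) (x, y) * ennreal (norm (x - y) powr (\<gamma> - real ?n)) * indicator UNIV y
        \<le> ennreal ((norm x / 2) powr (\<gamma> - real ?n)) * indicator (ball 0 R) y"
      proof (cases "(x, y) \<in> Eset t (\<gamma> / q) f")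
        case True
        have "f x = 0" using x R1 by (intro f0) simp
        then have "f y \<noteq> 0" using True t by (auto simp: Eset_def)
        then have y: "norm y < R" using f0[of y] by force
        have "norm x \<le> norm y + norm (x - y)" by norm
        then have "norm x / 2 \<le> norm (x - y)" using x y by simp
        then have "norm (x - y) powr (\<gamma> - real ?n) \<le> (norm x / 2) powr (\<gamma> - real ?n)"
          using x0 \<gamma> by (intro powr_mono2') auto
        then show ?thesis using y True by (simp add: ennreal_leI)
      qed simp
    qed
    also have "\<dots> = ennreal ((norm x / 2) powr (\<gamma> - real ?n) * m)"
      by (subst nn_integral_cmult_indicator) (auto simp: m ennreal_mult)
    finally have "enn2real (Eint t \<gamma> q UNIV x) \<le> (norm x / 2) powr (\<gamma> - real ?n) * m"
      using m by (intro enn2real_leI) auto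
    then have "Efun t \<gamma> q f x \<le> ((norm x / 2) powr (\<gamma> - real ?n) * m) powr (1 / q)"
      unfolding Efun_eq using q by (intro powr_mono2) auto
    also have "(norm x / 2) powr (\<gamma> - real ?n) = norm x powr (\<gamma> - real ?n) * 2 powr (real ?n - \<gamma>)"
      using x0 by (simp add: powr_divide powr_diff field_simps)
    also have "(norm x powr (\<gamma> - real ?n) * 2 powr (real ?n - \<gamma>) * m) powr (1 / q) = K * norm x powr ((\<gamma> - real ?n) * (1 / q))"
      using m(2) by (simp add: K_def powr_mult powr_powr ac_simps)
    also have "(\<gamma> - real ?n) * (1 / q) = - s" using q by (simp add: s_def field_simps)
    finally show ?thesis using x R1 by (simp add: w_def)
  qed
  have "Limsup (at_right 0) (\<lambda>t. ennreal t * N (Efun t \<gamma> q f)) \<le> ennreal (c * \<nu>)"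
  proof (rule Limsup_le_of_approx)
    show "c * \<nu> \<ge> 0" using c \<nu> by simp
    fix \<eta> :: real assume \<eta>: "\<eta> > 0"
    have "\<gamma> \<noteq> 0" using \<gamma> by simp
    then obtain C where C: "C \<ge> 0" "\<And>\<epsilon>. \<epsilon> > 0 \<Longrightarrow> \<exists>\<delta>. 0 < \<delta> \<and> \<delta> \<le> 1 \<and> (\<forall>x t W. t > 0 \<longrightarrow> 0 \<le> W \<longrightarrow> t powr q * W \<le> \<epsilon> powr q \<longrightarrow>
     Eint t \<gamma> q UNIV x \<le> Eint t \<gamma> q (ball x \<delta>) x + ennreal W \<longrightarrow>
     t * Efun t \<gamma> q f x \<le> (1 + \<eta>) * c * norm (Df x) + C * \<epsilon>)"
      unfolding c_def using Efun_estimate[OF q _ \<eta>] by metis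
    have "\<forall>\<^sub>F t in at_right 0. ennreal t * N (Efun t \<gamma> q f) \<le> ennreal ((1 + \<eta>) * (c * \<nu>) + (C * \<beta> + 1) * \<epsilon>)" if \<epsilon>: "\<epsilon> > 0" for \<epsilon>
    proof -
      obtain \<delta> where \<delta>: "0 < \<delta>" "\<delta> \<le> 1" "\<And>x t W. t > 0 \<Longrightarrow> 0 \<le> W \<Longrightarrow> t powr q * W \<le> \<epsilon> powr q \<Longrightarrow>
       Eint t \<gamma> q UNIV x \<le> Eint t \<gamma> q (ball x \<delta>) x + ennreal W \<Longrightarrow>
       t * Efun t \<gamma> q f x \<le> (1 + \<eta>) * c * norm (Df x) + C * \<epsilon>"
        using C(2)[OF \<epsilon>] by blast
      define I where "I = (\<integral>\<^sup>+z\<in>- ball (0::'a) \<delta>. ennreal (norm z powr (\<gamma> - real ?n)) \<partial>lborel)"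
      obtain W where W: "W \<ge> 0" "I = ennreal W"
        using nn_integral_power_tail_finite[OF \<gamma> \<delta>(1), where 'a='a] by (cases I) (auto simp: I_def)
      \<comment> \<open>Outside the small ball the indicator of the set is simply dropped, which
        makes \<open>W\<close> independent of x and t.\<close>
      have split: "Eint t \<gamma> q UNIV x \<le> Eint t \<gamma> q (ball x \<delta>) x + ennreal W" for t x
      proof -
        define T where "T z = ennreal (norm z powr (\<gamma> - real ?n)) * indicator (- ball 0 \<delta>) z" for z :: 'a
        have [measurable]: "T \<in> borel_measurable borel" unfolding T_def by measurable
        have [measurable]: "ball x \<delta> \<in> sets borel" by simp
        have "Eint t \<gamma> q UNIV x \<le> (\<integral>\<^sup>+y. indicator (Eset t (\<gamma> / q) f) (x, y) * ennreal (norm (x - y) powr (\<gamma> - real ?n)) * indicator (ball x \<delta>) y + T (- x + y) \<partial>lborel)"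
          unfolding Eint_def
          by (rule nn_integral_mono) (auto simp: indicator_def T_def dist_norm norm_minus_commute)
        also have "\<dots> = Eint t \<gamma> q (ball x \<delta>) x + (\<integral>\<^sup>+y. T (- x + y) \<partial>lborel)"
          unfolding Eint_def
        proof (rule nn_integral_add)
          have "(\<lambda>y. if (x, y) \<in> Eset t (\<gamma> / q) f then ennreal (norm (x - y) powr (\<gamma> - real ?n)) * indicator (ball x \<delta>) y else 0) \<in> borel_measurable lborel"
            by measurable
          also have "(\<lambda>y. if (x, y) \<in> Eset t (\<gamma> / q) f then ennreal (norm (x - y) powr (\<gamma> - real ?n)) * indicator (ball x \<delta>) y else 0)
            = (\<lambda>y. indicator (Eset t (\<gamma> / q) f) (x, y) * ennreal (norm (x - y) powr (\<gamma> - real ?n)) * indicator (ball x \<delta>) y)"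
            by (auto simp: indicator_def)
          finally show "(\<lambda>y. indicator (Eset t (\<gamma> / q) f) (x, y) * ennreal (norm (x - y) powr (\<gamma> - real ?n)) * indicator (ball x \<delta>) y) \<in> borel_measurable lborel" .
        qed measurable
        also have "(\<integral>\<^sup>+y. T (- x + y) \<partial>lborel) = I"
          unfolding I_def T_def[symmetric] by (rule nn_integral_lborel_translate) simp
        finally show ?thesis by (simp add: W)
      qed
      \<comment> \<open>The first bound gives \<open>t powr q * W \<le> \<epsilon> powr q\<close>,
        the second makes the norm of the far part, \<open>t * K * \<omega>\<close>, at most
        \<epsilon>; the latter is the 1 in the constant \<open>C * \<beta> + 1\<close>.\<close>
      define \<tau> where "\<tau> = min (\<epsilon> / (W + 1) powr (1 / q)) (\<epsilon> / (K * \<omega> + 1))"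
      have \<tau>: "\<tau> > 0" using \<epsilon> W K \<omega> by (simp add: \<tau>_def add_nonneg_pos)
      show ?thesis
        using eventually_at_right_less[of 0] eventually_at_rightI[OF _ \<tau>, of "\<lambda>t. t < \<tau>", simplified]
      proof eventually_elim
        case (elim t)
        have tW: "t powr q * W \<le> \<epsilon> powr q"
        proof -
          have "t \<le> \<epsilon> / (W + 1) powr (1 / q)" using elim(2) by (simp add: \<tau>_def)
          then have "t powr q \<le> (\<epsilon> / (W + 1) powr (1 / q)) powr q" using elim(1) q by (intro powr_mono2) auto
          also have "\<dots> = \<epsilon> powr q / (W + 1)" using \<epsilon> W q by (simp add: powr_divide powr_powr)
          finally have "t powr q * (W + 1) \<le> \<epsilon> powr q" using W by (simp add: field_simps)
          moreover have "t powr q * W \<le> t powr q * (W + 1)" by (intro mult_left_mono) auto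
          ultimately show ?thesis by linarith
        qed
        have tK: "t * K * \<omega> \<le> \<epsilon>"
        proof -
          have "t \<le> \<epsilon> / (K * \<omega> + 1)" using elim(2) by (simp add: \<tau>_def)
          then have "t * (K * \<omega> + 1) \<le> \<epsilon>" using K \<omega> by (simp add: pos_le_divide_eq add_nonneg_pos)
          then show ?thesis using elim(1) by (simp add: algebra_simps)
        qed
        have pt: "t * Efun t \<gamma> q f x \<le> ((1 + \<eta>) * c) * norm (Df x) + (C * \<epsilon>) * indicator (ball 0 (2 * R)) x + (t * K) * w x" for x
        proof (cases "norm x < 2 * R")
          case True
          have "t * Efun t \<gamma> q f x \<le> (1 + \<eta>) * c * norm (Df x) + C * \<epsilon>"
            using elim(1) W(1) tW split by (rule \<delta>(3))
          moreover have "t * K * w x \<ge> 0" using elim(1) K w by simp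
          ultimately show ?thesis using True by simp
        next
          case False
          then have "t * Efun t \<gamma> q f x \<le> t * (K * w x)"
            using elim(1) by (intro mult_left_mono far) auto
          moreover have "(1 + \<eta>) * c * norm (Df x) \<ge> 0" using \<eta> c by simp
          ultimately show ?thesis using False by (simp add: mult.assoc)
        qed
        have "ennreal t * N (Efun t \<gamma> q f) \<le> ennreal ((1 + \<eta>) * c) * ennreal \<nu> + ennreal (C * \<epsilon>) * ennreal \<beta> + ennreal (t * K) * ennreal \<omega>"
          unfolding \<nu>(2)[symmetric] \<beta>(2)[symmetric] \<omega>(2)[symmetric]
          by (rule N_combination[OF pt w]) (use elim \<eta> c C \<epsilon> K in auto)
        also have "\<dots> = ennreal ((1 + \<eta>) * c * \<nu> + C * \<epsilon> * \<beta> + t * K * \<omega>)"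
          using \<eta> c C(1) \<epsilon> \<nu>(1) \<beta>(1) \<omega>(1) K elim(1) by (simp flip: ennreal_mult ennreal_plus)
        also have "\<dots> \<le> ennreal ((1 + \<eta>) * (c * \<nu>) + (C * \<beta> + 1) * \<epsilon>)"
          using tK by (intro ennreal_leI) (simp add: algebra_simps)
        finally show ?case .
      qed
    qed
    then show "\<exists>C\<ge>0. \<forall>\<epsilon>>0. \<forall>\<^sub>F t in at_right 0. ennreal t * N (Efun t \<gamma> q f) \<le> ennreal ((1 + \<eta>) * (c * \<nu>) + C * \<epsilon>)"
      using C(1) \<beta>(1) by (intro exI[of _ "C * \<beta> + 1"]) auto
  qed
  then show ?thesis using c \<nu> \<gamma> by (simp add: c_def ennreal_mult)
qed

end

section \<open>Support conditions and conclusion\<close>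

lemma compact_closure_imp_ball:
  fixes S :: "'a::real_normed_vector set"
  assumes "compact (closure S)"
  obtains R where "R \<ge> 1" "\<And>x. R \<le> norm x \<Longrightarrow> x \<notin> closure S"
proof -
  obtain B where "\<And>x. x \<in> closure S \<Longrightarrow> norm x \<le> B"
    using compact_imp_bounded[OF assms] by (auto simp: bounded_iff)
  then show thesis using that[of "max 1 (B + 1)"] by force
qed

text \<open>Near such a point \<open>f\<close> vanishes identically, so uniqueness of the derivative
  applies. It passes from the support of \<open>f\<close>, given in (ii), to that of the
  gradient.\<close>

lemma GDERIV_eq_0_outside_support:
  assumes "GDERIV f x :> d" and x: "x \<notin> closure {x. f x \<noteq> 0}"
  shows "d = 0"
proof -
  have "(f has_derivative (\<lambda>h. h \<bullet> d)) (at x)" using assms(1) by (simp add: gderiv_def)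
  moreover have "(f has_derivative (\<lambda>h. 0)) (at x)"
  proof (rule has_derivative_transform_within_open[where s="- closure {x. f x \<noteq> 0}"])
    show "((\<lambda>x. 0) has_derivative (\<lambda>h. 0)) (at x)" by simp
    show "0 = f y" if "y \<in> - closure {x. f x \<noteq> 0}" for y
      using that closure_subset[of "{x. f x \<noteq> 0}"] by auto
  qed (use x in auto)
  ultimately have "(\<lambda>h. h \<bullet> d) = (\<lambda>h. 0)" by (rule has_derivative_unique)
  then have "d \<bullet> d = 0" by (rule fun_cong)
  then show ?thesis by simp
qed

theorem theorem3p22:
  fixes N :: "('a::euclidean_space \<Rightarrow> real) \<Rightarrow> ennreal"
  assumes X: "ball_BFS N"
  shows
   "(\<forall>(\<gamma>::real) (q::real) (f::'a \<Rightarrow> real) (Df::'a \<Rightarrow> 'a).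
       0 < \<gamma> \<and> 0 < q \<and> (\<forall>x. GDERIV f x :> Df x) \<and> continuous_on UNIV Df
       \<and> compact (closure {x. Df x \<noteq> 0}) \<longrightarrow>
       Limsup at_top (\<lambda>t. ennreal t * N (Efun t \<gamma> q f))
         \<le> ennreal ((kappa q TYPE('a) / \<gamma>) powr (1 / q)) * N (\<lambda>x. norm (Df x)))
  \<and> (\<forall>(p::real) (\<gamma>::real) (q::real) (f::'a \<Rightarrow> real) (Df::'a \<Rightarrow> 'a).
       1 \<le> p \<and> \<gamma> < 0 \<and> 0 < q \<and> q < (real DIM('a) - \<gamma>) / real DIM('a) * p
       \<and> ball_BFS (convexify N (1 / p))
       \<and> maximal_bounded_on (assoc_norm (convexify N (1 / p)))
       \<and> (\<forall>x. GDERIV f x :> Df x) \<and> continuous_on UNIV Df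
       \<and> compact (closure {x. f x \<noteq> 0}) \<longrightarrow>
       Limsup (at_right 0) (\<lambda>t. ennreal t * N (Efun t \<gamma> q f))
         \<le> ennreal ((- kappa q TYPE('a) / \<gamma>) powr (1 / q)) * N (\<lambda>x. norm (Df x)))"
proof (intro conjI allI impI; elim conjE)
  fix \<gamma> q :: real and f :: "'a \<Rightarrow> real" and Df :: "'a \<Rightarrow> 'a"
  assume *: "0 < \<gamma>" "0 < q" "\<forall>x. GDERIV f x :> Df x" "continuous_on UNIV Df" "compact (closure {x. Df x \<noteq> 0})"
  obtain R where Rb: "R \<ge> 1" "\<And>x. R \<le> norm x \<Longrightarrow> x \<notin> closure {x. Df x \<noteq> 0}"
    using compact_closure_imp_ball[OF *(5)] by blast
  interpret BFS_gradient N f Df R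
  proof
    show "Df x = 0" if "R \<le> norm x" for x
      using Rb(2)[OF that] closure_subset[of "{x. Df x \<noteq> 0}"] by auto
  qed (use X * Rb in auto)
  show "Limsup at_top (\<lambda>t. ennreal t * N (Efun t \<gamma> q f))
         \<le> ennreal ((kappa q TYPE('a) / \<gamma>) powr (1 / q)) * N (\<lambda>x. norm (Df x))"
    using *(1,2) by (rule Limsup_Efun_at_top)
next
  fix p \<gamma> q :: real and f :: "'a \<Rightarrow> real" and Df :: "'a \<Rightarrow> 'a"
  assume *: "1 \<le> p" "\<gamma> < 0" "0 < q" "q < (real DIM('a) - \<gamma>) / real DIM('a) * p"
    "ball_BFS (convexify N (1 / p))" "maximal_bounded_on (assoc_norm (convexify N (1 / p)))"
    "\<forall>x. GDERIV f x :> Df x" "continuous_on UNIV Df" "compact (closure {x. f x \<noteq> 0})"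
  obtain R where Rb: "R \<ge> 1" "\<And>x. R \<le> norm x \<Longrightarrow> x \<notin> closure {x. f x \<noteq> 0}"
    using compact_closure_imp_ball[OF *(9)] by blast
  interpret BFS_gradient N f Df R
  proof
    show "Df x = 0" if "R \<le> norm x" for x
      using *(7) Rb(2)[OF that] by (intro GDERIV_eq_0_outside_support[of f x]) auto
  qed (use X * Rb in auto)
  show "Limsup (at_right 0) (\<lambda>t. ennreal t * N (Efun t \<gamma> q f))
         \<le> ennreal ((- kappa q TYPE('a) / \<gamma>) powr (1 / q)) * N (\<lambda>x. norm (Df x))"
  proof (rule Limsup_Efun_at_right_0[OF *(2,3)])
    show "f x = 0" if "R \<le> norm x" for x
      using Rb(2)[OF that] closure_subset[of "{x. f x \<noteq> 0}"] by auto
    \<comment> \<open>The upper bound on \<open>q\<close>, multiplied by \<open>n / q\<close>: this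
      is the decay condition \<open>s * p > n\<close>.\<close>
    have "(real DIM('a) - \<gamma>) / q * p > real DIM('a)"
      using *(3,4) by (simp add: field_simps)
    then show "N (\<lambda>x. norm x powr - ((real DIM('a) - \<gamma>) / q) * indicator (- ball 0 1) x) < \<infinity>"
      using *(1,5,6) by (intro power_decay_finite_of_convexify) auto
  qed (rule Rb(1))
qed

end
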